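(* \textsc{MaxAvgCutOpt} is polynomial-time Turing reducible to \textsc{MaxAvgCut}. Here \textsc{MaxAvgCutOpt} is the problem: given a connected graph $G$ with edge weights $w_e \in \{-1,1\}$, output a nontrivial partition $(A,B)$ of $V(G)$ maximizing $\left(\sum_{e\in\delta(A)} w_e\right)/|\delta(A)|$ over all nontrivial partitions. \textsc{MaxAvgCut} is the decision problem: given a connected multigraph $G$ with edge weights $w_e \in \{-1,1\}$ and a rational number $k \ge -1$, output YES if there is a nontrivial partition $(A,B)$ of $V(G)$ with $\left(\sum_{e\in\delta(A)} w_e\right)/|\delta(A)| \ge k$, and NO otherwise.
   Context: For $A \subseteq V(G)$, $\delta(A)$ denotes the set of edges of the (multi)graph with exactly one endpoint in $A$. A partition $(A,B)$ of $V(G)$ is nontrivial if both $A$ and $B$ are nonempty. *)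

theory Defs
  imports Complex_Main "HOL-Computational_Algebra.Polynomial"
begin

section \<open>Weighted multigraphs and average cuts\<close>

record ('v, 'e) wgraph =
  verts :: "'v set"
  edges :: "'e set"
  ends :: "'e \<Rightarrow> 'v set"
  weight :: "'e \<Rightarrow> int"

text \<open>Parallel edges are distinct elements of \<^const>\<open>edges\<close> with the same ends; there are no loops.\<close>

definition multigraph :: "('v, 'e) wgraph \<Rightarrow> bool" where
  "multigraph G \<longleftrightarrow> finite (verts G) \<and> verts G \<noteq> {} \<and> finite (edges G) \<and>
     (\<forall>e\<in>edges G. ends G e \<subseteq> verts G \<and> card (ends G e) = 2 \<and> weight G e \<in> {-1, 1})"

definition simple_graph :: "('v, 'e) wgraph \<Rightarrow> bool" where
  "simple_graph G \<longleftrightarrow> multigraph G \<and> inj_on (ends G) (edges G)"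

definition adjacent :: "('v, 'e) wgraph \<Rightarrow> ('v \<times> 'v) set" where
  "adjacent G = {(u, v). \<exists>e\<in>edges G. ends G e = {u, v}}"

definition connected_graph :: "('v, 'e) wgraph \<Rightarrow> bool" where
  "connected_graph G \<longleftrightarrow> (\<forall>u\<in>verts G. \<forall>v\<in>verts G. (u, v) \<in> (adjacent G)\<^sup>*)"

definition cut :: "('v, 'e) wgraph \<Rightarrow> 'v set \<Rightarrow> 'e set" where
  "cut G A = {e \<in> edges G. card (ends G e \<inter> A) = 1}"

definition nontrivial_partition :: "('v, 'e) wgraph \<Rightarrow> 'v set \<Rightarrow> 'v set \<Rightarrow> bool" where
  "nontrivial_partition G A B \<longleftrightarrow>
     A \<union> B = verts G \<and> A \<inter> B = {} \<and> A \<noteq> {} \<and> B \<noteq> {}"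

definition cut_average :: "('v, 'e) wgraph \<Rightarrow> 'v set \<Rightarrow> rat" where
  "cut_average G A = of_int (\<Sum>e\<in>cut G A. weight G e) / of_nat (card (cut G A))"

definition max_average_partition :: "('v, 'e) wgraph \<Rightarrow> 'v set \<Rightarrow> 'v set \<Rightarrow> bool" where
  "max_average_partition G A B \<longleftrightarrow> nontrivial_partition G A B \<and>
     (\<forall>A' B'. nontrivial_partition G A' B' \<longrightarrow> cut_average G A' \<le> cut_average G A)"

section \<open>Deterministic multitape oracle Turing machines\<close>

datatype 'a cell = Blank | Letter 'a | Aux nat

datatype dir = MoveL | Stay | MoveR

text \<open>A tape is two-way infinite and comes with the position of its head.  Tape 0 initially
  holds the input, tape 1 is the query tape and tape 2 the output tape.\<close>

type_synonym 'a tape = "(int \<Rightarrow> 'a cell) \<times> int"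

type_synonym 'a config = "nat \<times> 'a tape list"

record 'a otm =
  states :: "nat set"
  alphabet :: "'a cell set"
  tapes :: nat
  start_state :: nat
  halt_state :: nat
  query_state :: nat
  yes_state :: nat
  no_state :: nat
  trans :: "nat \<Rightarrow> 'a cell list \<Rightarrow> nat \<times> ('a cell \<times> dir) list"

definition wf_otm :: "'a otm \<Rightarrow> bool" where
  "wf_otm M \<longleftrightarrow>
     finite (states M) \<and>
     {start_state M, halt_state M, query_state M, yes_state M, no_state M} \<subseteq> states M \<and>
     halt_state M \<noteq> query_state M \<and>
     finite (alphabet M) \<and> Blank \<in> alphabet M \<and> range Letter \<subseteq> alphabet M \<and>
     3 \<le> tapes M \<and>
     (\<forall>q\<in>states M. \<forall>cs. length cs = tapes M \<and> set cs \<subseteq> alphabet M \<longrightarrow>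
        (case trans M q cs of (q', acts) \<Rightarrow>
           q' \<in> states M \<and> length acts = tapes M \<and> fst ` set acts \<subseteq> alphabet M))"

definition content :: "'a list \<Rightarrow> int \<Rightarrow> 'a cell" where
  "content w i = (if 0 \<le> i \<and> i < int (length w) then Letter (w ! nat i) else Blank)"

definition initial_config :: "'a otm \<Rightarrow> 'a list \<Rightarrow> 'a config" where
  "initial_config M x =
     (start_state M, (content x, 0) # replicate (tapes M - 1) (content [], 0))"

fun offset :: "dir \<Rightarrow> int" where
  "offset MoveL = -1"
| "offset Stay = 0"
| "offset MoveR = 1"

fun act :: "'a cell \<times> dir \<Rightarrow> 'a tape \<Rightarrow> 'a tape" where
  "act (c, d) (f, h) = (f(h := c), h + offset d)"

text \<open>A query takes one step: the next state tells whether the content of the query tape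
  is a word of the oracle language.  The halting state is never left.\<close>

definition step :: "'a otm \<Rightarrow> 'a list set \<Rightarrow> 'a config \<Rightarrow> 'a config" where
  "step M L cfg = (case cfg of (q, ts) \<Rightarrow>
     if q = halt_state M then (q, ts)
     else if q = query_state M then
       (if \<exists>w\<in>L. fst (ts ! 1) = content w then yes_state M else no_state M, ts)
     else (case trans M q (map (\<lambda>(f, h). f h) ts) of (q', acts) \<Rightarrow> (q', map2 act acts ts)))"

definition outputs_within :: "'a otm \<Rightarrow> 'a list set \<Rightarrow> 'a list \<Rightarrow> nat \<Rightarrow> 'a list \<Rightarrow> bool" where
  "outputs_within M L x t y \<longleftrightarrow>
     (case (step M L ^^ t) (initial_config M x) of (q, ts) \<Rightarrow>
        q = halt_state M \<and> fst (ts ! 2) = content y)"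

section \<open>Polynomial-time Turing reductions from search to decision problems\<close>

record 'a search_problem =
  instances :: "'a list set"
  solutions :: "'a list \<Rightarrow> 'a list set"

text \<open>To solve a search problem means to output a solution of the given instance if it has one,
  and to report that there is none, by the empty output, otherwise.\<close>

definition poly_time_turing_reducible ::
    "('a::finite) search_problem \<Rightarrow> 'a list set \<Rightarrow> bool" where
  "poly_time_turing_reducible P L \<longleftrightarrow>
     (\<exists>M. wf_otm M \<and> (\<exists>p :: nat poly. \<forall>x\<in>instances P. \<exists>y.
        outputs_within M L x (poly p (length x)) y \<and>
        (if solutions P x = {} then y = [] else y \<in> solutions P x)))"

section \<open>Encodings\<close>

datatype letter = Bit0 | Bit1 | Plus | Minus | Comma | Semicolon

instance letter :: finite
proof
  have "(UNIV :: letter set) = {Bit0, Bit1, Plus, Minus, Comma, Semicolon}"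
    using letter.exhaust by blast
  then show "finite (UNIV :: letter set)"
    by (metis finite.emptyI finite.insertI)
qed

text \<open>Numbers are written in binary, least significant bit first; zero has no digits.\<close>

fun binary :: "nat \<Rightarrow> letter list" where
  "binary n = (if n = 0 then [] else (if odd n then Bit1 else Bit0) # binary (n div 2))"

declare binary.simps [simp del]

definition enc_nat :: "nat \<Rightarrow> letter list" where
  "enc_nat n = binary n @ [Comma]"

definition enc_sign :: "int \<Rightarrow> letter" where
  "enc_sign z = (if z < 0 then Minus else Plus)"

definition enc_rat :: "rat \<Rightarrow> letter list" where
  "enc_rat k = (case quotient_of k of (a, b) \<Rightarrow>
     enc_sign a # enc_nat (nat \<bar>a\<bar>) @ enc_nat (nat b))"

definition enc_vertices :: "nat list \<Rightarrow> letter list" where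
  "enc_vertices vs = concat (map enc_nat vs) @ [Semicolon]"

fun enc_edge :: "nat \<times> nat \<times> int \<Rightarrow> letter list" where
  "enc_edge (u, v, w) = enc_nat u @ enc_nat v @ [enc_sign w]"

definition enc_graph :: "nat list \<Rightarrow> (nat \<times> nat \<times> int) list \<Rightarrow> letter list" where
  "enc_graph vs es = enc_vertices vs @ concat (map enc_edge es) @ [Semicolon]"

text \<open>The multigraph presented by a list of vertices and a list of weighted edges; the edges
  are the positions in the second list.\<close>

definition graph_of :: "nat list \<Rightarrow> (nat \<times> nat \<times> int) list \<Rightarrow> (nat, nat) wgraph" where
  "graph_of vs es =
     \<lparr>verts = set vs, edges = {..<length es},
      ends = (\<lambda>i. case es ! i of (u, v, w) \<Rightarrow> {u, v}),
      weight = (\<lambda>i. case es ! i of (u, v, w) \<Rightarrow> w)\<rparr>"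

section \<open>The two problems\<close>

definition MaxAvgCutOpt :: "letter search_problem" where
  "MaxAvgCutOpt =
     \<lparr>instances = {enc_graph vs es | vs es.
        distinct vs \<and> simple_graph (graph_of vs es) \<and> connected_graph (graph_of vs es)},
      solutions = (\<lambda>x. {enc_vertices as @ enc_vertices bs | as bs. distinct as \<and> distinct bs \<and>
        (\<exists>vs es. x = enc_graph vs es \<and> distinct vs \<and>
           simple_graph (graph_of vs es) \<and> connected_graph (graph_of vs es) \<and>
           max_average_partition (graph_of vs es) (set as) (set bs))})\<rparr>"

definition MaxAvgCut :: "letter list set" where
  "MaxAvgCut = {enc_graph vs es @ enc_rat k | vs es k.
     distinct vs \<and> multigraph (graph_of vs es) \<and> connected_graph (graph_of vs es) \<and> k \<ge> -1 \<and>
     (\<exists>A B. nontrivial_partition (graph_of vs es) A B \<and> cut_average (graph_of vs es) A \<ge> k)}"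

end

theory Submission
  imports Defs
begin

text \<open>All queries use the threshold \<open>k = 0\<close>; what varies is the multigraph.  For an instance of length
  \<open>n\<close> with edges \<open>es\<close>, take \<open>n\<^sup>2\<close> copies of \<open>es\<close> together with \<open>n\<^sup>2\<close> copies of \<open>es\<close> with all weights
  replaced by \<open>-1\<close>, and \<open>a\<close> copies with all weights replaced by \<open>1\<close>.  A cut with \<open>c\<close> edges, \<open>d\<close> of them
  negative, has weight \<open>a c - 2 n\<^sup>2 d\<close> there, so the query asks for a cut with \<open>d / c \<le> a / (2 n\<^sup>2)\<close>.
  For the least \<open>a\<close> with a positive answer, the cuts of nonnegative weight are exactly the optimal
  ones, because distinct values \<open>d / c\<close> differ by more than \<open>1 / n\<^sup>2\<close>; moreover every cut has
  weight less than \<open>n\<close>.  Hence \<open>n\<close> parallel edges of weight \<open>-1\<close> between the first vertex and \<open>v\<close> force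
  \<open>v\<close> to the side of the first vertex.  The vertices \<open>v\<close> are tried one after the other; after a
  negative answer the new edges are neutralised by \<open>n\<close> parallel edges of weight \<open>1\<close>.  The query word
  thus only ever grows (up to its fixed end), and the machine needs no arithmetic: it merely copies
  parts of its input.\<close>

text \<open>At threshold 0 only the sign of the total weight of a cut matters, and its size drops
  out. Weights add up over concatenated edge lists, so blocks of edges can be analysed separately,
  and two opposite parallel bundles cancel although they enlarge the denominator of the average. The
  concrete machine model dictates the rest. Multiplicities arise from walking over copies of the
  input, so \<open>n\<close> is the length of the input word; the separation argument only needs
  that it exceeds the number of edges. The query word reaches cubic length, but the head of the
  query tape rests at its end and a round merely removes the fixed end and appends a few blocks.
  Hence a round takes quadratic time whatever the length of the query, and with at most
  quadratically many rounds the whole run is quartic. Graphs with one vertex have no nontrivial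
  partition, so the search for \<open>a\<close> would never get a positive answer; they are
  recognised beforehand.\<close>

section \<open>Structured programs for oracle machines\<close>

datatype 'a com =
    Op nat "'a cell \<Rightarrow> 'a cell" nat dir
  | Seq "'a com" "'a com" (infixr ";;" 60)
  | Cond nat "'a cell \<Rightarrow> bool" "'a com" "'a com"
  | Loop nat "'a cell \<Rightarrow> bool" "'a com"

definition scanned :: "'a tape list \<Rightarrow> nat \<Rightarrow> 'a cell" where
  "scanned ts i = fst (ts ! i) (snd (ts ! i))"

text \<open>The times are exact: expanding a sequence and testing a condition or a loop guard each
  cost one machine step, in which the control only rewrites its stack.\<close>

inductive exec :: "'a com \<Rightarrow> 'a tape list \<Rightarrow> nat \<Rightarrow> 'a tape list \<Rightarrow> bool" where
  Op: "exec (Op s f t d) ts 1 (ts[t := act (f (scanned ts s), d) (ts ! t)])"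
| Seq: "exec a ts m ts' \<Longrightarrow> exec b ts' n ts'' \<Longrightarrow> exec (a ;; b) ts (Suc (m + n)) ts''"
| CondT: "P (scanned ts s) \<Longrightarrow> exec a ts m ts' \<Longrightarrow> exec (Cond s P a b) ts (Suc m) ts'"
| CondF: "\<not> P (scanned ts s) \<Longrightarrow> exec b ts m ts' \<Longrightarrow> exec (Cond s P a b) ts (Suc m) ts'"
| LoopT: "P (scanned ts s) \<Longrightarrow> exec c ts m ts' \<Longrightarrow> exec (Loop s P c) ts' n ts'' \<Longrightarrow>
    exec (Loop s P c) ts (Suc (m + n)) ts''"
| LoopF: "\<not> P (scanned ts s) \<Longrightarrow> exec (Loop s P c) ts 1 ts"

definition plain_cells :: "'a cell set" where
  "plain_cells = insert Blank (range Letter)"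

fun wf_com :: "nat \<Rightarrow> 'a com \<Rightarrow> bool" where
  "wf_com k (Op s f t d) \<longleftrightarrow> s < k \<and> t < k \<and> f ` plain_cells \<subseteq> plain_cells"
| "wf_com k (a ;; b) \<longleftrightarrow> wf_com k a \<and> wf_com k b"
| "wf_com k (Cond s P a b) \<longleftrightarrow> s < k \<and> wf_com k a \<and> wf_com k b"
| "wf_com k (Loop s P c) \<longleftrightarrow> s < k \<and> wf_com k c"

text \<open>The finite control of the machine is a stack of commands that remain to be executed;
  \<open>stacks c s\<close> are the stacks that occur while \<open>c\<close> is executed on top of \<open>s\<close>.\<close>

fun stacks :: "'a com \<Rightarrow> 'a com list \<Rightarrow> 'a com list set" where
  "stacks (Op x f y d) s = {Op x f y d # s}"
| "stacks (a ;; b) s = insert ((a ;; b) # s) (stacks a (b # s) \<union> stacks b s)"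
| "stacks (Cond x P a b) s = insert (Cond x P a b # s) (stacks a s \<union> stacks b s)"
| "stacks (Loop x P c) s = insert (Loop x P c # s) (stacks c (Loop x P c # s))"

fun next_stack :: "'a com list \<Rightarrow> 'a cell list \<Rightarrow> 'a com list" where
  "next_stack [] cs = []"
| "next_stack (Op x f y d # s) cs = s"
| "next_stack ((a ;; b) # s) cs = a # b # s"
| "next_stack (Cond x P a b # s) cs = (if P (cs ! x) then a else b) # s"
| "next_stack (Loop x P c # s) cs = (if P (cs ! x) then c # Loop x P c # s else s)"

definition idle :: "'a cell list \<Rightarrow> ('a cell \<times> dir) list" where
  "idle cs = map (\<lambda>c. (c, Stay)) cs"

fun stack_acts :: "'a com list \<Rightarrow> 'a cell list \<Rightarrow> ('a cell \<times> dir) list" where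
  "stack_acts (Op x f y d # s) cs = (idle cs)[y := (f (cs ! x), d)]"
| "stack_acts s cs = idle cs"

section \<open>Finiteness and closure of the command stacks\<close>

lemma finite_stacks: "finite (stacks c s)"
  by (induction c arbitrary: s) auto

lemma top_in_stacks: "c # s \<in> stacks c s"
  by (cases c) auto

text \<open>The extra element \<open>s\<close> is the case in which \<open>c\<close> has just been
  completed and its continuation remains.\<close>

lemma stacks_closed: "u \<in> stacks c s \<Longrightarrow> next_stack u cs \<in> insert s (stacks c s)"
proof (induction c arbitrary: s)
  case (Seq a b)
  consider "u = (a ;; b) # s" | "u \<in> stacks a (b # s)" | "u \<in> stacks b s"
    using Seq.prems by auto
  then show ?case
  proof cases
    case 2
    then show ?thesis using Seq.IH(1)[OF 2] top_in_stacks[of b s] by auto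
  next
    case 3
    then show ?thesis using Seq.IH(2)[OF 3] by auto
  qed (simp add: top_in_stacks)
next
  case (Cond x P a b)
  then show ?case using top_in_stacks[of a s] top_in_stacks[of b s] by auto
next
  case (Loop x P c)
  consider "u = Loop x P c # s" | "u \<in> stacks c (Loop x P c # s)"
    using Loop.prems by auto
  then show ?case
  proof cases
    case 2
    then show ?thesis using Loop.IH[OF 2] by auto
  qed (simp add: top_in_stacks)
qed simp

lemma stack_acts_plain:
  assumes "u \<in> stacks c s" "wf_com k c" "length cs = k" "set cs \<subseteq> plain_cells"
  shows "length (stack_acts u cs) = k \<and> fst ` set (stack_acts u cs) \<subseteq> plain_cells"
proof -
  have idle: "length (idle cs) = k" "fst ` set (idle cs) \<subseteq> plain_cells"
    using assms by (auto simp: idle_def)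
  show ?thesis using assms(1,2)
  proof (induction c arbitrary: s)
    case (Op x f y d)
    then have "cs ! x \<in> plain_cells" using assms by auto
    then have "f (cs ! x) \<in> plain_cells" using Op by auto
    then show ?case using Op idle set_update_subset_insert[of "idle cs" y "(f (cs ! x), d)"]
      by (simp add: image_subset_iff) (metis (no_types, lifting) fst_conv insertE subsetD)
  qed (use idle in \<open>fastforce simp: image_subset_iff\<close>)+
qed

lemma map2_act_idle:
  "map2 act (idle (map (\<lambda>(f, h). f h) ts)) ts = ts"
  by (induction ts) (auto simp: idle_def)

lemma map2_act_update:
  assumes "y < length ts"
  shows "map2 act ((idle (map (\<lambda>(f, h). f h) ts))[y := a]) ts = ts[y := act a (ts ! y)]"
proof (rule nth_equalityI)
  fix i assume i: "i < length (map2 act ((idle (map (\<lambda>(f, h). f h) ts))[y := a]) ts)"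
  have "map2 act (idle (map (\<lambda>(f, h). f h) ts)) ts ! i = ts ! i"
    by (simp add: map2_act_idle)
  with i assms show "map2 act ((idle (map (\<lambda>(f, h). f h) ts))[y := a]) ts ! i
      = ts[y := act a (ts ! y)] ! i"
    by (cases "i = y") (auto simp: idle_def)
qed (simp add: idle_def)

lemma funpow_addI: "(f ^^ m) x = y \<Longrightarrow> (f ^^ n) y = z \<Longrightarrow> (f ^^ (m + n)) x = z"
  by (metis add.commute comp_apply funpow_add)

lemma funpow_SucI: "f x = y \<Longrightarrow> (f ^^ n) y = z \<Longrightarrow> (f ^^ Suc n) x = z"
  by (simp add: funpow_swap1)

datatype 'a control = Run "'a com list" | Ask | Stop

text \<open>An oracle machine has a single query state and a single pair of answer states, so a program
  consists of an initial command and of two commands that handle the two answers.  Whenever one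
  of them is finished, the flag tape tells whether to halt or to query again.\<close>

locale oracle_program =
  fixes k :: nat and Init Yes No :: "'a::finite com" and flag :: nat and fin :: "'a cell \<Rightarrow> bool"
  assumes k: "3 \<le> k" and flag: "flag < k"
    and wf: "wf_com k Init" "wf_com k Yes" "wf_com k No"
begin

definition controls :: "'a control set" where
  "controls = {Ask, Stop, Run []} \<union> Run ` (stacks Init [] \<union> stacks Yes [] \<union> stacks No [])"

text \<open>States of an \<open>otm\<close> must be natural numbers. Finiteness of
  \<open>controls\<close> provides an injective numbering, and nothing depends on which one is
  chosen.\<close>

definition code :: "'a control \<Rightarrow> nat" where
  "code = (SOME f. inj_on f controls)"

definition decode :: "nat \<Rightarrow> 'a control" where
  "decode = inv_into controls code"

fun next_control :: "'a control \<Rightarrow> 'a cell list \<Rightarrow> 'a control" where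
  "next_control (Run []) cs = (if fin (cs ! flag) then Stop else Ask)"
| "next_control (Run s) cs = Run (next_stack s cs)"
| "next_control q cs = q"

fun control_acts :: "'a control \<Rightarrow> 'a cell list \<Rightarrow> ('a cell \<times> dir) list" where
  "control_acts (Run s) cs = stack_acts s cs"
| "control_acts q cs = idle cs"

definition machine :: "'a otm" where
  "machine = \<lparr>states = code ` controls, alphabet = plain_cells, tapes = k,
     start_state = code (Run [Init]), halt_state = code Stop, query_state = code Ask,
     yes_state = code (Run [Yes]), no_state = code (Run [No]),
     trans = (\<lambda>q cs. (code (next_control (decode q) cs), control_acts (decode q) cs))\<rparr>"

lemma inj_code: "inj_on code controls"
proof -
  have "finite controls"
    by (simp add: controls_def finite_stacks)
  then have "\<exists>f :: 'a control \<Rightarrow> nat. inj_on f controls"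
    using finite_imp_inj_to_nat_seg by blast
  then show ?thesis unfolding code_def by (rule someI_ex)
qed

lemma decode_code: "q \<in> controls \<Longrightarrow> decode (code q) = q"
  by (simp add: decode_def inj_code)

lemma code_eq_iff: "q \<in> controls \<Longrightarrow> q' \<in> controls \<Longrightarrow> code q = code q' \<longleftrightarrow> q = q'"
  using inj_code by (meson inj_onD)

lemma controls_basic: "Ask \<in> controls" "Stop \<in> controls" "Run [] \<in> controls"
    "Run [Init] \<in> controls" "Run [Yes] \<in> controls" "Run [No] \<in> controls"
  by (auto simp: controls_def top_in_stacks)

lemma next_control_closed: "q \<in> controls \<Longrightarrow> next_control q cs \<in> controls"
proof (cases "(q, cs)" rule: next_control.cases)
  case (2 c s cs')
  assume "q \<in> controls"
  then obtain d where d: "Run ` stacks d [] \<subseteq> controls" "c # s \<in> stacks d []"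
    using 2 by (auto simp: controls_def)
  then show ?thesis
    using 2 stacks_closed[OF d(2), of cs] controls_def by auto
qed (auto simp: controls_def)

lemma wf_machine: "wf_otm machine"
proof -
  have "length (control_acts q cs) = k \<and> fst ` set (control_acts q cs) \<subseteq> plain_cells"
    if "q \<in> controls" "length cs = k" "set cs \<subseteq> plain_cells" for q cs
  proof -
    have "length (idle cs) = k \<and> fst ` set (idle cs) \<subseteq> plain_cells"
      using that by (auto simp: idle_def)
    moreover have "length (stack_acts s cs) = k \<and> fst ` set (stack_acts s cs) \<subseteq> plain_cells"
      if q: "q = Run s" for s
    proof (cases s)
      case Nil
      then show ?thesis using calculation by simp
    next
      case (Cons c s')
      then obtain d where "wf_com k d" "s \<in> stacks d []"
        using that q wf \<open>q \<in> controls\<close> by (auto simp: controls_def)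
      then show ?thesis using stack_acts_plain \<open>length cs = k\<close> \<open>set cs \<subseteq> plain_cells\<close> by blast
    qed
    ultimately show ?thesis by (cases q) auto
  qed
  moreover have "finite controls"
    by (simp add: controls_def finite_stacks)
  moreover have "finite (plain_cells :: 'a cell set)" by (simp add: plain_cells_def)
  ultimately show ?thesis
    using k controls_basic next_control_closed code_eq_iff[of Stop Ask]
    by (auto simp: wf_otm_def machine_def decode_code plain_cells_def)
qed

section \<open>Simulation of structured programs by the machine\<close>

lemma step_run:
  assumes "Run (c # s) \<in> controls"
  shows "step machine L (code (Run (c # s)), ts) =
    (code (Run (next_stack (c # s) (map (\<lambda>(f, h). f h) ts))),
     map2 act (stack_acts (c # s) (map (\<lambda>(f, h). f h) ts)) ts)"
  using assms controls_basic code_eq_iff[of "Run (c # s)"]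
  by (simp add: step_def machine_def decode_code)

lemma nth_scanned: "i < length ts \<Longrightarrow> (case ts ! i of (f, h) \<Rightarrow> f h) = scanned ts i"
  by (simp add: scanned_def case_prod_unfold)

lemma exec_length: "exec c ts m ts' \<Longrightarrow> length ts' = length ts"
  by (induction rule: exec.induct) auto

text \<open>The continuation \<open>s\<close> is arbitrary so that the induction passes through
  sequences and loops. All stacks of the execution have to lie in \<open>controls\<close>, since
  only there does \<open>decode\<close> invert \<open>code\<close>.\<close>

lemma machine_exec:
  assumes "exec c ts m ts'" "wf_com k c" "length ts = k" "Run ` insert s (stacks c s) \<subseteq> controls"
  shows "(step machine L ^^ m) (code (Run (c # s)), ts) = (code (Run s), ts')"
  using assms
proof (induction arbitrary: s rule: exec.induct)
  case (Op x f y d ts)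
  then show ?case by (simp add: step_run map2_act_update nth_scanned)
next
  case (Seq a ts m ts' b n ts'')
  have "Run ` insert (b # s) (stacks a (b # s)) \<subseteq> controls" "Run ` insert s (stacks b s) \<subseteq> controls"
    "Run ((a ;; b) # s) \<in> controls"
    using Seq.prems top_in_stacks[of b s] by auto
  then have "step machine L (code (Run ((a ;; b) # s)), ts) = (code (Run (a # b # s)), ts)"
    "(step machine L ^^ m) (code (Run (a # b # s)), ts) = (code (Run (b # s)), ts')"
    "(step machine L ^^ n) (code (Run (b # s)), ts') = (code (Run s), ts'')"
    using Seq.prems exec_length[OF Seq.hyps(1)] Seq.IH by (simp_all add: step_run map2_act_idle)
  then show ?case by (intro funpow_SucI funpow_addI)
next
  case (CondT P ts x a m ts' b)
  then show ?case
    by (intro funpow_SucI) (auto simp: step_run map2_act_idle nth_scanned)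
next
  case (CondF P ts x b m ts' a)
  then show ?case
    by (intro funpow_SucI) (auto simp: step_run map2_act_idle nth_scanned)
next
  case (LoopT P ts x c m ts' n ts'')
  have "Run ` insert (Loop x P c # s) (stacks c (Loop x P c # s)) \<subseteq> controls"
    using LoopT.prems by auto
  then have "step machine L (code (Run (Loop x P c # s)), ts) = (code (Run (c # Loop x P c # s)), ts)"
    "(step machine L ^^ m) (code (Run (c # Loop x P c # s)), ts) = (code (Run (Loop x P c # s)), ts')"
    "(step machine L ^^ n) (code (Run (Loop x P c # s)), ts') = (code (Run s), ts'')"
    using LoopT.prems LoopT.hyps(1) exec_length[OF LoopT.hyps(2)] LoopT.IH
    by (simp_all add: step_run map2_act_idle nth_scanned)
  then show ?case by (intro funpow_SucI funpow_addI)
next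
  case (LoopF P ts x c)
  then show ?case
    by (simp add: step_run map2_act_idle nth_scanned)
qed

text \<open>A bound on the time suffices because the halting configuration is a fixed point of
  \<open>step\<close>: \<open>stop_outputs\<close> pads a run to the exact time that
  \<open>outputs_within\<close> asks for.\<close>

definition reaches :: "'a list set \<Rightarrow> nat \<times> 'a tape list \<Rightarrow> nat \<Rightarrow> nat \<times> 'a tape list \<Rightarrow> bool" where
  "reaches L cfg m cfg' \<longleftrightarrow> (\<exists>n\<le>m. (step machine L ^^ n) cfg = cfg')"

lemma reaches_trans:
  assumes "reaches L cfg m cfg'" "reaches L cfg' n cfg''"
  shows "reaches L cfg (m + n) cfg''"
proof -
  obtain i j where "i \<le> m" "j \<le> n" "(step machine L ^^ i) cfg = cfg'"
    "(step machine L ^^ j) cfg' = cfg''"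
    using assms unfolding reaches_def by blast
  then have "(step machine L ^^ (j + i)) cfg = cfg''" "j + i \<le> m + n"
    by (auto simp: funpow_add)
  then show ?thesis unfolding reaches_def by blast
qed

lemma reaches_mono: "reaches L cfg m cfg' \<Longrightarrow> m \<le> n \<Longrightarrow> reaches L cfg n cfg'"
  unfolding reaches_def using order_trans by blast

lemma reaches_handler:
  assumes "c \<in> {Init, Yes, No}" "exec c ts m ts'" "length ts = k"
  shows "reaches L (code (Run [c]), ts) (Suc m)
    (code (if fin (scanned ts' flag) then Stop else Ask), ts')"
proof -
  have "(step machine L ^^ m) (code (Run [c]), ts) = (code (Run []), ts')"
    using assms wf by (intro machine_exec) (auto simp: controls_def)
  moreover have "step machine L (code (Run []), ts')
      = (code (if fin (scanned ts' flag) then Stop else Ask), ts')"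
    using controls_basic code_eq_iff[of "Run []"] exec_length[OF assms(2)] flag assms(3)
    by (simp add: step_def machine_def decode_code map2_act_idle nth_scanned)
  ultimately have "(step machine L ^^ Suc m) (code (Run [c]), ts)
      = (code (if fin (scanned ts' flag) then Stop else Ask), ts')"
    by simp
  then show ?thesis unfolding reaches_def by blast
qed

lemma content_inject: "content u = content w \<longleftrightarrow> u = w"
proof
  assume eq: "content u = content w"
  have "length u = length w"
  proof (rule ccontr)
    assume "length u \<noteq> length w"
    \<comment> \<open>At the position where the shorter word ends, one tape shows a blank and the
      other a letter.\<close>
    then show False
      using fun_cong[OF eq, of "int (min (length u) (length w))"]
      by (auto simp: content_def min_def split: if_splits)
  qed
  then show "u = w"
    using fun_cong[OF eq, of "int i" for i]
    by (intro nth_equalityI) (simp_all add: content_def, metis cell.inject(1) nat_int)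
qed simp

lemma reaches_query:
  assumes "fst (ts ! 1) = content q"
  shows "reaches L (code Ask, ts) 1 (code (Run [if q \<in> L then Yes else No]), ts)"
proof -
  have "(\<exists>w\<in>L. fst (ts ! 1) = content w) \<longleftrightarrow> q \<in> L"
    using assms by (auto simp: content_inject)
  then have "step machine L (code Ask, ts) = (code (Run [if q \<in> L then Yes else No]), ts)"
    using controls_basic code_eq_iff[of Ask Stop] by (simp add: step_def machine_def)
  then show ?thesis unfolding reaches_def by (intro exI[of _ 1]) simp
qed

lemma stop_outputs:
  assumes "reaches L (initial_config machine x) m (code Stop, ts)" "m \<le> n" "fst (ts ! 2) = content y"
  shows "outputs_within machine L x n y"
proof -
  obtain i where i: "i \<le> m" "(step machine L ^^ i) (initial_config machine x) = (code Stop, ts)"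
    using assms unfolding reaches_def by blast
  have "step machine L (code Stop, ts) = (code Stop, ts)"
    by (simp add: step_def machine_def)
  then have "(step machine L ^^ j) (code Stop, ts) = (code Stop, ts)" for j
    by (induction j) auto
  moreover have "(n - i) + i = n" using i assms by simp
  ultimately have "(step machine L ^^ n) (initial_config machine x) = (code Stop, ts)"
    using i(2) by (metis funpow_add comp_apply)
  then show ?thesis using assms by (simp add: outputs_within_def machine_def)
qed

lemma initial_config_machine:
  "initial_config machine x = (code (Run [Init]), (content x, 0) # replicate (k - 1) (content [], 0))"
  by (simp add: initial_config_def machine_def)

end

section \<open>Basic programs\<close>

definition runs :: "'a com \<Rightarrow> 'a tape list \<Rightarrow> nat \<Rightarrow> 'a tape list \<Rightarrow> bool" where
  "runs c ts T ts' \<longleftrightarrow> (\<exists>m\<le>T. exec c ts m ts')"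

lemma runs_mono: "runs c ts T ts' \<Longrightarrow> T \<le> T' \<Longrightarrow> runs c ts T' ts'"
  unfolding runs_def using order_trans by blast

lemma runs_Op: "runs (Op s f t d) ts 1 (ts[t := act (f (scanned ts s), d) (ts ! t)])"
  unfolding runs_def using exec.Op by blast

lemma runs_Seq: "runs a ts S ts' \<Longrightarrow> runs b ts' T ts'' \<Longrightarrow> runs (a ;; b) ts (Suc (S + T)) ts''"
  unfolding runs_def by (meson Suc_le_mono add_mono exec.Seq)

lemma runs_SeqI:
  "runs a ts S ts' \<Longrightarrow> runs b ts' T ts'' \<Longrightarrow> Suc (S + T) \<le> U \<Longrightarrow> runs (a ;; b) ts U ts''"
  using runs_Seq runs_mono by blast

lemma runs_CondT: "P (scanned ts s) \<Longrightarrow> runs a ts T ts' \<Longrightarrow> runs (Cond s P a b) ts (Suc T) ts'"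
  unfolding runs_def by (meson Suc_le_mono exec.CondT)

lemma runs_CondF: "\<not> P (scanned ts s) \<Longrightarrow> runs b ts T ts' \<Longrightarrow> runs (Cond s P a b) ts (Suc T) ts'"
  unfolding runs_def by (meson Suc_le_mono exec.CondF)

lemma runs_LoopT: "P (scanned ts s) \<Longrightarrow> runs c ts S ts' \<Longrightarrow> runs (Loop s P c) ts' T ts'' \<Longrightarrow>
    runs (Loop s P c) ts (Suc (S + T)) ts''"
  unfolding runs_def by (meson Suc_le_mono add_mono exec.LoopT)

lemma runs_LoopF: "\<not> P (scanned ts s) \<Longrightarrow> runs (Loop s P c) ts 1 ts"
  unfolding runs_def using exec.LoopF by blast

text \<open>A zipper: the head stands between \<open>p\<close> and \<open>r\<close>, on the first
  letter of \<open>r\<close>. With \<open>r = []\<close> it is on the blank behind the word, ready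
  to append.\<close>

definition mark :: "'a list \<Rightarrow> 'a list \<Rightarrow> 'a tape" where
  "mark p r = (content (p @ r), int (length p))"

fun head_cell :: "'a list \<Rightarrow> 'a cell" where
  "head_cell [] = Blank"
| "head_cell (c # r) = Letter c"

lemma scanned_mark: "ts ! s = mark p r \<Longrightarrow> scanned ts s = head_cell r"
  by (cases r) (auto simp: scanned_def mark_def content_def nth_append)

lemma act_mark:
  "act (Letter c, MoveR) (mark u []) = mark (u @ [c]) []"
  "act (Letter c, MoveR) (mark p (c # r)) = mark (p @ [c]) r"
  "act (head_cell r, MoveL) (mark (p @ [c]) r) = mark p (c # r)"
  "act (Blank, Stay) (mark u [c]) = mark u []"
  "length u \<le> 1 \<Longrightarrow> act (Letter c, Stay) (mark [] u) = mark [] [c]"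
  by (cases r; auto simp: mark_def content_def nth_append fun_eq_iff)+

definition move :: "nat \<Rightarrow> dir \<Rightarrow> 'a com" where
  "move t d = Op t id t d"

definition put :: "'a \<Rightarrow> nat \<Rightarrow> 'a com" where
  "put c t = Op t (\<lambda>_. Letter c) t MoveR"

definition copy_while :: "nat \<Rightarrow> ('a cell \<Rightarrow> bool) \<Rightarrow> ('a \<Rightarrow> 'a) \<Rightarrow> nat \<Rightarrow> 'a com" where
  "copy_while s P f t = Loop s P (Op s (map_cell f) t MoveR ;; move s MoveR)"

text \<open>The first move matters: the head may rest on a delimiter at which \<open>P\<close>
  already fails, and the loop is to find the previous one. The last move leaves the head just behind
  it.\<close>

definition rewind :: "nat \<Rightarrow> ('a cell \<Rightarrow> bool) \<Rightarrow> 'a com" where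
  "rewind t P = move t MoveL ;; Loop t P (move t MoveL) ;; move t MoveR"

text \<open>The word on tape \<open>t\<close> serves as a unary counter. The concluding rewind makes
  it reusable, which nested loops and later rounds rely on.\<close>

definition for_cells :: "nat \<Rightarrow> 'a com \<Rightarrow> 'a com" where
  "for_cells t c = Loop t (\<lambda>x. x \<noteq> Blank) (c ;; move t MoveR) ;; rewind t (\<lambda>x. x \<noteq> Blank)"

definition append_word :: "nat \<Rightarrow> nat \<Rightarrow> 'a com" where
  "append_word s t = copy_while s (\<lambda>x. x \<noteq> Blank) id t ;; rewind s (\<lambda>x. x \<noteq> Blank)"

definition erase_last :: "nat \<Rightarrow> 'a com" where
  "erase_last t = move t MoveL ;; Op t (\<lambda>_. Blank) t Stay"

definition store :: "'a \<Rightarrow> nat \<Rightarrow> 'a com" where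
  "store c t = Op t (\<lambda>_. Letter c) t Stay"

section \<open>Effect and running time of the basic programs\<close>

lemma runs_move_right:
  "ts ! t = mark p (c # r) \<Longrightarrow> runs (move t MoveR) ts 1 (ts[t := mark (p @ [c]) r])"
  using runs_Op[of t id t MoveR ts] by (simp add: move_def scanned_mark act_mark)

lemma runs_move_left:
  "ts ! t = mark (p @ [c]) r \<Longrightarrow> runs (move t MoveL) ts 1 (ts[t := mark p (c # r)])"
  using runs_Op[of t id t MoveL ts] by (simp add: move_def scanned_mark act_mark)

lemma runs_put: "ts ! t = mark u [] \<Longrightarrow> runs (put c t) ts 1 (ts[t := mark (u @ [c]) []])"
  using runs_Op[of t "\<lambda>_. Letter c" t MoveR ts] by (simp add: put_def act_mark)

lemma runs_store: "ts ! t = mark [] u \<Longrightarrow> length u \<le> 1 \<Longrightarrow> runs (store c t) ts 1 (ts[t := mark [] [c]])"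
  using runs_Op[of t "\<lambda>_. Letter c" t Stay ts] by (simp add: store_def act_mark)

lemma runs_erase_last:
  assumes "t < length ts" "ts ! t = mark (u @ [c]) []"
  shows "runs (erase_last t) ts 3 (ts[t := mark u []])"
proof -
  have "runs (Op t (\<lambda>_. Blank) t Stay) (ts[t := mark u [c]]) 1 (ts[t := mark u []])"
    using runs_Op[of t "\<lambda>_. Blank" t Stay "ts[t := mark u [c]]"] assms(1) by (simp add: act_mark)
  with runs_move_left[OF assms(2)] show ?thesis
    unfolding erase_last_def by (rule runs_SeqI) simp
qed

lemma runs_copy_while:
  assumes "s \<noteq> t" "s < length ts" "t < length ts" "ts ! s = mark p (z @ r)" "ts ! t = mark u []"
    "\<forall>c\<in>set z. P (Letter c)" "\<not> P (head_cell r)"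
  shows "runs (copy_while s P f t) ts (4 * length z + 1)
    (ts[s := mark (p @ z) r, t := mark (u @ map f z) []])"
  using assms
proof (induction z arbitrary: ts p u)
  case Nil
  then have "ts[s := mark p r, t := mark u []] = ts"
    using list_update_id[of ts s] list_update_id[of ts t] by simp
  with Nil show ?case
    using runs_LoopF[of P ts s] by (simp add: copy_while_def scanned_mark)
next
  case (Cons c z)
  let ?body = "Op s (map_cell f) t MoveR ;; move s MoveR"
  let ?ts1 = "ts[t := mark (u @ [f c]) []]"
  let ?ts2 = "?ts1[s := mark (p @ [c]) (z @ r)]"
  have scan: "scanned ts s = Letter c"
    using Cons.prems(4) by (simp add: scanned_mark)
  have "runs (Op s (map_cell f) t MoveR) ts 1 ?ts1"
    using runs_Op[of s "map_cell f" t MoveR ts] Cons.prems(5) scan by (simp add: act_mark)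
  moreover have "runs (move s MoveR) ?ts1 1 ?ts2"
    by (rule runs_move_right) (use Cons.prems in simp)
  ultimately have body: "runs ?body ts 3 ?ts2"
    by (rule runs_SeqI) simp
  have "runs (copy_while s P f t) ?ts2 (4 * length z + 1)
     (?ts2[s := mark ((p @ [c]) @ z) r, t := mark ((u @ [f c]) @ map f z) []])"
    by (rule Cons.IH) (use Cons.prems in auto)
  then have rest: "runs (copy_while s P f t) ?ts2 (4 * length z + 1)
     (ts[s := mark (p @ c # z) r, t := mark (u @ map f (c # z)) []])"
    using Cons.prems(1) by (simp add: list_update_swap)
  have "P (scanned ts s)" using scan Cons.prems(6) by simp
  from runs_LoopT[OF this body rest[unfolded copy_while_def]] show ?case
    by (simp add: copy_while_def)
qed

lemma runs_move:
  "ts ! t = (g, h) \<Longrightarrow> runs (move t d) ts 1 (ts[t := (g, h + offset d)])"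
  using runs_Op[of t id t d ts] by (simp add: move_def scanned_def)

text \<open>Head positions are integers here because the stopping cell may be the blank at position
  -1, where \<open>mark\<close> cannot place the head.\<close>

lemma runs_rewind_int:
  assumes "t < length ts" "ts ! t = (g, h)" "l < h" "\<forall>i. l < i \<and> i < h \<longrightarrow> P (g i)" "\<not> P (g l)"
  shows "runs (rewind t P) ts (2 * nat (h - l) + 3) (ts[t := (g, l + 1)])"
proof -
  have loop: "runs (Loop t P (move t MoveL)) (ts[t := (g, l + int n)]) (2 * n + 1) (ts[t := (g, l)])"
    if "l + int n < h" for n
    using that
  proof (induction n)
    case 0
    then show ?case using runs_LoopF[of P "ts[t := (g, l)]" t] assms by (simp add: scanned_def)
  next
    case (Suc n)
    have "runs (move t MoveL) (ts[t := (g, l + int (Suc n))]) 1 (ts[t := (g, l + int n)])"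
      using runs_move[of "ts[t := (g, l + int (Suc n))]" t g "l + int (Suc n)" MoveL] assms(1)
      by (simp add: algebra_simps)
    from runs_LoopT[of P _ t, OF _ this Suc.IH] Suc.prems assms show ?case
      by (simp add: scanned_def)
  qed
  define n where "n = nat (h - 1 - l)"
  have n: "h - 1 = l + int n" "l + int n < h" using assms(3) by (auto simp: n_def)
  have "runs (move t MoveL) ts 1 (ts[t := (g, l + int n)])"
    using runs_move[OF assms(2), of MoveL] n by simp
  moreover have "runs (move t MoveR) (ts[t := (g, l)]) 1 (ts[t := (g, l + 1)])"
    using runs_move[of "ts[t := (g, l)]" t g l MoveR] assms(1) by simp
  ultimately have "runs (rewind t P) ts (Suc (1 + Suc ((2 * n + 1) + 1))) (ts[t := (g, l + 1)])"
    unfolding rewind_def using runs_Seq loop[OF n(2)] by blast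
  moreover have "nat (h - l) = Suc n" using n by simp
  ultimately show ?thesis by (auto intro: runs_mono)
qed

lemma runs_rewind:
  assumes "t < length ts" "ts ! t = mark (p @ c # z) r" "\<not> P (Letter c)" "\<forall>c\<in>set z. P (Letter c)"
  shows "runs (rewind t P) ts (2 * length z + 5) (ts[t := mark (p @ [c]) (z @ r)])"
proof -
  have "P (content (p @ c # z @ r) i)" if i: "int (length p) < i" "i < int (length (p @ c # z))" for i
  proof -
    obtain j where j: "j < length z" "i = int (length p + Suc j)"
    proof (rule that)
      show "nat (i - int (length p) - 1) < length z"
        "i = int (length p + Suc (nat (i - int (length p) - 1)))"
        using i by auto
    qed
    then have "content (p @ c # z @ r) i = Letter (z ! j)"
      by (simp add: content_def nat_add_distrib nth_append)
    then show ?thesis using assms(4) j(1) by simp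
  qed
  then have "runs (rewind t P) ts (2 * nat (int (length (p @ c # z)) - int (length p)) + 3)
      (ts[t := (content (p @ c # z @ r), int (length p) + 1)])"
    using assms by (intro runs_rewind_int) (auto simp: mark_def content_def)
  then show ?thesis
    by (simp add: mark_def add.commute) (erule runs_mono, simp)
qed

lemma runs_rewind_blank:
  assumes "t < length ts" "ts ! t = mark z r"
  shows "runs (rewind t (\<lambda>x. x \<noteq> Blank)) ts (2 * length z + 5) (ts[t := mark [] (z @ r)])"
proof -
  have "runs (rewind t (\<lambda>x. x \<noteq> Blank)) ts (2 * nat (int (length z) - (-1)) + 3)
      (ts[t := (content (z @ r), -1 + 1)])"
    by (rule runs_rewind_int) (use assms in \<open>auto simp: mark_def content_def\<close>)
  then show ?thesis by (simp add: mark_def) (erule runs_mono, simp)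
qed

lemma runs_append_word:
  assumes "s \<noteq> t" "s < length ts" "t < length ts" "ts ! s = mark [] w" "ts ! t = mark u []"
  shows "runs (append_word s t) ts (6 * length w + 7) (ts[t := mark (u @ w) []])"
proof -
  let ?ts = "ts[s := mark w [], t := mark (u @ w) []]"
  have "runs (copy_while s (\<lambda>x. x \<noteq> Blank) id t) ts (4 * length w + 1) ?ts"
    using runs_copy_while[of s t ts "[]" w "[]" u "\<lambda>x. x \<noteq> Blank" id] assms by simp
  moreover have "runs (rewind s (\<lambda>x. x \<noteq> Blank)) ?ts (2 * length w + 5) (?ts[s := mark [] w])"
    using runs_rewind_blank[of s ?ts w "[]"] assms by simp
  moreover have "?ts[s := mark [] w] = ts[t := mark (u @ w) []]"
    using assms list_update_id[of ts s] by (simp add: list_update_swap)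
  ultimately have "runs (append_word s t) ts (Suc (4 * length w + 1 + (2 * length w + 5)))
      (ts[t := mark (u @ w) []])"
    unfolding append_word_def using runs_Seq by metis
  then show ?thesis by (rule runs_mono) simp
qed

text \<open>\<open>S i\<close> describes the memory after \<open>i\<close> rounds. The counter tape
  is overwritten explicitly, so that one family \<open>S\<close> serves for every position of its
  head.\<close>

lemma runs_for_cells:
  assumes len: "\<And>i. length (S i) = k" "t < k"
    and body: "\<And>i. i < length w \<Longrightarrow> runs c ((S i)[t := mark (take i w) (drop i w)]) T
        ((S (Suc i))[t := mark (take i w) (drop i w)])"
  shows "runs (for_cells t c) ((S 0)[t := mark [] w]) (length w * (T + 5) + 7)
    ((S (length w))[t := mark [] w])"
proof -
  let ?L = "Loop t (\<lambda>x. x \<noteq> Blank) (c ;; move t MoveR)"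
  let ?S = "\<lambda>j i. (S j)[t := mark (take i w) (drop i w)]"
  have nth: "?S j i ! t = mark (take i w) (drop i w)" for i j
    using len by simp
  have loop: "runs ?L (?S i i) ((length w - i) * (T + 3) + 1) (?S (length w) (length w))"
    if "i \<le> length w" for i
    using that
  proof (induction i rule: inc_induct)
    case base
    then show ?case
      using runs_LoopF[of "\<lambda>x. x \<noteq> Blank" "?S (length w) (length w)" t] scanned_mark[OF nth[of "length w" "length w"]]
      by simp
  next
    case (step i)
    have d: "drop i w = w ! i # drop (Suc i) w" "take (Suc i) w = take i w @ [w ! i]"
      using step(2) by (simp_all add: Cons_nth_drop_Suc take_Suc_conv_app_nth)
    have "runs (move t MoveR) (?S (Suc i) i) 1 (?S (Suc i) (Suc i))"
      using runs_move_right[of "?S (Suc i) i" t] nth[of "Suc i" i] unfolding d by simp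
    with body[OF step(2)] have b: "runs (c ;; move t MoveR) (?S i i) (T + 2) (?S (Suc i) (Suc i))"
      by (rule runs_SeqI) simp
    have "length w - i = Suc (length w - Suc i)" using step(2) by simp
    then have e: "Suc (T + 2 + ((length w - Suc i) * (T + 3) + 1)) = (length w - i) * (T + 3) + 1"
      by simp
    have "scanned (?S i i) t \<noteq> Blank"
      using scanned_mark[OF nth[of i i]] d by simp
    from runs_LoopT[where P = "\<lambda>x. x \<noteq> Blank", OF this b step(3)] show ?case
      unfolding e .
  qed
  have "runs (rewind t (\<lambda>x. x \<noteq> Blank)) ((S (length w))[t := mark w []]) (2 * length w + 5)
     ((S (length w))[t := mark [] w])"
    using runs_rewind_blank[of t "(S (length w))[t := mark w []]" w "[]"] len by simp
  with loop[of 0, simplified] show ?thesis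
    unfolding for_cells_def by (rule runs_SeqI) (simp_all add: algebra_simps)
qed

lemma wf_com_basic [simp]:
  "wf_com k (move t d) \<longleftrightarrow> t < k"
  "wf_com k (put c t) \<longleftrightarrow> t < k"
  "wf_com k (store c t) \<longleftrightarrow> t < k"
  "wf_com k (copy_while s P f t) \<longleftrightarrow> s < k \<and> t < k"
  "wf_com k (rewind t P) \<longleftrightarrow> t < k"
  "wf_com k (for_cells t b) \<longleftrightarrow> t < k \<and> wf_com k b"
  "wf_com k (append_word s t) \<longleftrightarrow> s < k \<and> t < k"
  "wf_com k (erase_last t) \<longleftrightarrow> t < k"
  by (auto simp: move_def put_def store_def copy_while_def rewind_def for_cells_def append_word_def
      erase_last_def plain_cells_def)

section \<open>The program of the reduction\<close>

text \<open>The delimiter is copied too, but the head of tape \<open>s\<close> stays on it: from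
  there \<open>rewind\<close> finds the start of the same entry, and one \<open>move\<close> reaches
  the next entry.\<close>

definition copy_through :: "nat \<Rightarrow> 'a \<Rightarrow> nat \<Rightarrow> 'a com" where
  "copy_through s c t = copy_while s (\<lambda>x. x \<noteq> Letter c) id t ;; Op s id t MoveR"

lemma runs_copy_through:
  assumes "s \<noteq> t" "s < length ts" "t < length ts" "ts ! s = mark p (z @ c # r)" "ts ! t = mark u []"
    "c \<notin> set z"
  shows "runs (copy_through s c t) ts (4 * length z + 3)
    (ts[s := mark (p @ z) (c # r), t := mark (u @ z @ [c]) []])"
proof -
  let ?ts = "ts[s := mark (p @ z) (c # r), t := mark (u @ z) []]"
  have "runs (copy_while s (\<lambda>x. x \<noteq> Letter c) id t) ts (4 * length z + 1) ?ts"
    using runs_copy_while[of s t ts p z "c # r" u "\<lambda>x. x \<noteq> Letter c" id] assms by auto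
  moreover have "scanned ?ts s = Letter c"
    using scanned_mark[of ?ts s "p @ z" "c # r"] assms by simp
  then have "runs (Op s id t MoveR) ?ts 1 (ts[s := mark (p @ z) (c # r), t := mark (u @ z @ [c]) []])"
    using runs_Op[of s id t MoveR ?ts] assms by (simp add: act_mark)
  ultimately show ?thesis
    unfolding copy_through_def by (rule runs_SeqI) simp
qed

text \<open>Tape 0 holds the input, tape 1 the query and tape 2 the output.  Tapes 3, 4 and 8 hold copies
  of the input: the first two are unary counters, the last one is used to walk through the list of
  vertices.  Tape 5 holds the first vertex, tape 6 the vertices separated from it, and tape 7 a
  flag that is blank while the optimal average is searched, \<^const>\<open>Plus\<close> while the partition is
  computed and \<^const>\<open>Semicolon\<close> at the end.\<close>

definition mem :: "letter tape \<Rightarrow> letter list \<Rightarrow> letter list \<Rightarrow> letter tape \<Rightarrow> letter tape \<Rightarrow>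
    letter list \<Rightarrow> letter list \<Rightarrow> letter list \<Rightarrow> letter tape \<Rightarrow> letter tape list" where
  "mem t0 q u t3 t4 v b f t8 =
     [t0, mark q [], mark u [], t3, t4, mark [] v, mark b [], mark [] f, t8]"

lemma length_mem [simp]: "length (mem t0 q u t3 t4 v b f t8) = 9"
  by (simp add: mem_def)

lemma mem_nth [simp]:
  "mem t0 q u t3 t4 v b f t8 ! 0 = t0"
  "mem t0 q u t3 t4 v b f t8 ! Suc 0 = mark q []"
  "mem t0 q u t3 t4 v b f t8 ! 2 = mark u []"
  "mem t0 q u t3 t4 v b f t8 ! 3 = t3"
  "mem t0 q u t3 t4 v b f t8 ! 4 = t4"
  "mem t0 q u t3 t4 v b f t8 ! 5 = mark [] v"
  "mem t0 q u t3 t4 v b f t8 ! 6 = mark b []"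
  "mem t0 q u t3 t4 v b f t8 ! 7 = mark [] f"
  "mem t0 q u t3 t4 v b f t8 ! 8 = t8"
  by (simp_all add: mem_def)

lemma mem_update [simp]:
  "(mem t0 q u t3 t4 v b f t8)[0 := t] = mem t q u t3 t4 v b f t8"
  "(mem t0 q u t3 t4 v b f t8)[Suc 0 := mark q' []] = mem t0 q' u t3 t4 v b f t8"
  "(mem t0 q u t3 t4 v b f t8)[2 := mark u' []] = mem t0 q u' t3 t4 v b f t8"
  "(mem t0 q u t3 t4 v b f t8)[3 := t] = mem t0 q u t t4 v b f t8"
  "(mem t0 q u t3 t4 v b f t8)[4 := t] = mem t0 q u t3 t v b f t8"
  "(mem t0 q u t3 t4 v b f t8)[5 := mark [] v'] = mem t0 q u t3 t4 v' b f t8"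
  "(mem t0 q u t3 t4 v b f t8)[6 := mark b' []] = mem t0 q u t3 t4 v b' f t8"
  "(mem t0 q u t3 t4 v b f t8)[7 := mark [] f'] = mem t0 q u t3 t4 v b f' t8"
  "(mem t0 q u t3 t4 v b f t8)[8 := t] = mem t0 q u t3 t4 v b f t"
  by (simp_all add: mem_def numeral_eq_Suc)

lemma scanned_mem:
  "scanned (mem t0 q u t3 t4 v b f t8) 7 = head_cell f"
  "scanned (mem t0 q u t3 t4 v b f (mark p r)) 8 = head_cell r"
  by (simp_all add: scanned_mark)

text \<open>The fixed end of every query: the mark closing the edge list and the code of the
  rational 0, that is, a sign, a numerator without digits and the denominator 1 (see
  \<open>enc_rat_zero\<close>).\<close>

definition question :: "letter list" where
  "question = [Semicolon, Plus, Comma, Bit1, Comma]"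

definition put_question :: "letter com" where
  "put_question = put Semicolon 1 ;; put Plus 1 ;; put Comma 1 ;; put Bit1 1 ;; put Comma 1"

definition erase_question :: "letter com" where
  "erase_question = erase_last 1 ;; erase_last 1 ;; erase_last 1 ;; erase_last 1 ;; erase_last 1"

text \<open>Signs occur in edge codes only as weights, so a letterwise substitution reweights a
  whole edge list; see \<open>map_to_plus_enc_edges\<close>.\<close>

definition to_plus :: "letter \<Rightarrow> letter" where
  "to_plus c = (if c = Minus then Plus else c)"

definition to_minus :: "letter \<Rightarrow> letter" where
  "to_minus c = (if c = Plus then Minus else c)"

definition append_edges :: "(letter \<Rightarrow> letter) \<Rightarrow> letter com" where
  "append_edges f = copy_while 0 (\<lambda>x. x \<noteq> Letter Semicolon) f 1 ;;
     rewind 0 (\<lambda>x. x \<noteq> Letter Semicolon)"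

text \<open>The \<open>rewind\<close> returns to the start of the current vertex on tape 8, so that
  the command can be repeated inside \<open>for_cells\<close>.\<close>

definition add_edge :: "letter \<Rightarrow> letter com" where
  "add_edge c = append_word 5 1 ;; copy_through 8 Comma 1 ;; rewind 8 (\<lambda>x. x \<noteq> Letter Comma) ;;
     put c 1"

definition ask_vertex :: "letter com" where
  "ask_vertex = for_cells 3 (add_edge Minus) ;; put_question"

definition finish :: "letter com" where
  "finish = put Semicolon 2 ;; rewind 6 (\<lambda>x. x \<noteq> Blank) ;; copy_while 6 (\<lambda>x. x \<noteq> Blank) id 2 ;;
     put Semicolon 2 ;; store Semicolon 7"

definition next_vertex :: "letter com" where
  "next_vertex = move 8 MoveR ;; Cond 8 (\<lambda>x. x = Letter Semicolon) finish ask_vertex"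

text \<open>With a blank flag the least \<open>a\<close> has just been found, and the first vertex
  test begins. Otherwise the tested vertex joins the output and its negative edges stay in the
  query, where they keep forcing it.\<close>

definition yes_handler :: "letter com" where
  "yes_handler = erase_question ;; Cond 7 (\<lambda>x. x = Blank)
     (store Plus 7 ;; ask_vertex)
     (copy_through 8 Comma 2 ;; next_vertex)"

text \<open>With a blank flag, one more positive copy of the edges raises \<open>a\<close> by 1.
  Otherwise the rejected vertex is stored on tape 6, because the side of the first vertex has to be
  written completely before the other side.\<close>

definition no_handler :: "letter com" where
  "no_handler = erase_question ;; Cond 7 (\<lambda>x. x = Blank)
     (append_edges to_plus ;; put_question)
     (for_cells 3 (add_edge Plus) ;; copy_through 8 Comma 6 ;; next_vertex)"

text \<open>The nested loops over two copies of the input produce the multiplicity n^2. The final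
  positive copy makes \<open>a = 1\<close> the first value asked for.\<close>

definition prepare :: "letter com" where
  "prepare = append_word 5 2 ;; copy_through 0 Semicolon 1 ;; move 0 MoveR ;;
     for_cells 3 (for_cells 4 (append_edges to_minus ;; append_edges id)) ;;
     append_edges to_plus ;; put_question"

text \<open>A semicolon right behind the first vertex reveals a graph with one vertex. The flag then
  stops the machine while the output tape is still empty, which is the required report that no
  solution exists.\<close>

definition init :: "letter com" where
  "init = append_word 0 3 ;; rewind 3 (\<lambda>x. x \<noteq> Blank) ;;
     append_word 0 4 ;; rewind 4 (\<lambda>x. x \<noteq> Blank) ;;
     append_word 0 8 ;; rewind 8 (\<lambda>x. x \<noteq> Blank) ;;
     copy_through 8 Comma 5 ;; rewind 5 (\<lambda>x. x \<noteq> Blank) ;; move 8 MoveR ;;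
     Cond 8 (\<lambda>x. x = Letter Semicolon) (store Semicolon 7) prepare"

lemmas program_defs = copy_through_def put_question_def erase_question_def append_edges_def
  add_edge_def ask_vertex_def finish_def next_vertex_def yes_handler_def no_handler_def
  prepare_def init_def

interpretation reduction: oracle_program 9 init yes_handler no_handler 7 "\<lambda>x. x = Letter Semicolon"
  by unfold_locales (simp_all add: program_defs)

section \<open>Effect and running time of the pieces of the program\<close>

lemma runs_put_mem: "runs (put c 1) (mem t0 q u t3 t4 v b f t8) 1 (mem t0 (q @ [c]) u t3 t4 v b f t8)"
  using runs_put[of "mem t0 q u t3 t4 v b f t8" 1 q c] by simp

lemma runs_put_question:
  "runs put_question (mem t0 q u t3 t4 v b f t8) 9 (mem t0 (q @ question) u t3 t4 v b f t8)"
  unfolding put_question_def question_def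
  using runs_Seq[OF runs_put_mem[of Semicolon t0 q] runs_Seq[OF runs_put_mem[of Plus]
      runs_Seq[OF runs_put_mem[of Comma] runs_Seq[OF runs_put_mem[of Bit1] runs_put_mem[of Comma]]]]]
  by (simp add: numeral_eq_Suc)

lemma runs_erase_last_mem:
  "runs (erase_last 1) (mem t0 (q @ [c]) u t3 t4 v b f t8) 3 (mem t0 q u t3 t4 v b f t8)"
  using runs_erase_last[of 1 "mem t0 (q @ [c]) u t3 t4 v b f t8" q c] by simp

lemma runs_erase_question:
  "runs erase_question (mem t0 (q @ question) u t3 t4 v b f t8) 19 (mem t0 q u t3 t4 v b f t8)"
  unfolding erase_question_def question_def
  using runs_Seq[OF runs_erase_last_mem[of t0 "q @ [Semicolon, Plus, Comma, Bit1]" Comma]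
      runs_Seq[OF runs_erase_last_mem[of t0 "q @ [Semicolon, Plus, Comma]" Bit1, simplified]
      runs_Seq[OF runs_erase_last_mem[of t0 "q @ [Semicolon, Plus]" Comma, simplified]
      runs_Seq[OF runs_erase_last_mem[of t0 "q @ [Semicolon]" Plus, simplified]
      runs_erase_last_mem[of t0 q Semicolon]]]], simplified]
  by (simp add: numeral_eq_Suc)

lemma runs_append_edges:
  assumes "Semicolon \<notin> set e"
  shows "runs (append_edges g) (mem (mark (p @ [Semicolon]) (e @ Semicolon # r)) q u t3 t4 v b f t8)
     (6 * length e + 7)
     (mem (mark (p @ [Semicolon]) (e @ Semicolon # r)) (q @ map g e) u t3 t4 v b f t8)"
proof -
  let ?P = "\<lambda>x. x \<noteq> Letter Semicolon"
  let ?m = "mem (mark (p @ [Semicolon]) (e @ Semicolon # r)) q u t3 t4 v b f t8"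
  let ?m' = "mem (mark (p @ Semicolon # e) (Semicolon # r)) (q @ map g e) u t3 t4 v b f t8"
  have e: "\<forall>c\<in>set e. ?P (Letter c)" using assms by auto
  have "runs (copy_while 0 ?P g 1) ?m (4 * length e + 1) ?m'"
    using runs_copy_while[of 0 1 ?m "p @ [Semicolon]" e "Semicolon # r" q ?P g] e by simp
  moreover have "runs (rewind 0 ?P) ?m' (2 * length e + 5)
      (mem (mark (p @ [Semicolon]) (e @ Semicolon # r)) (q @ map g e) u t3 t4 v b f t8)"
    using runs_rewind[of 0 ?m' p Semicolon e "Semicolon # r" ?P] e by simp
  ultimately show ?thesis
    unfolding append_edges_def by (rule runs_SeqI) simp
qed

lemma runs_add_edge:
  assumes "Comma \<notin> set z"
  shows "runs (add_edge c) (mem t0 q u t3 t4 v b f (mark (p @ [Comma]) (z @ Comma # r)))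
     (6 * length v + 6 * length z + 19)
     (mem t0 (q @ v @ z @ [Comma, c]) u t3 t4 v b f (mark (p @ [Comma]) (z @ Comma # r)))"
proof -
  let ?P = "\<lambda>x. x \<noteq> Letter Comma"
  let ?t = "mark (p @ [Comma]) (z @ Comma # r)" and ?t' = "mark (p @ Comma # z) (Comma # r)"
  let ?m1 = "mem t0 q u t3 t4 v b f ?t"
  let ?m2 = "mem t0 (q @ v) u t3 t4 v b f ?t"
  let ?m3 = "mem t0 (q @ v @ z @ [Comma]) u t3 t4 v b f ?t'"
  let ?m4 = "mem t0 (q @ v @ z @ [Comma]) u t3 t4 v b f ?t"
  have 1: "runs (append_word 5 1) ?m1 (6 * length v + 7) ?m2"
    using runs_append_word[of 5 1 ?m1 v q] by simp
  have 2: "runs (copy_through 8 Comma 1) ?m2 (4 * length z + 3) ?m3"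
    using runs_copy_through[of 8 1 ?m2 "p @ [Comma]" z Comma r "q @ v"] assms by simp
  have "\<forall>c\<in>set z. ?P (Letter c)" using assms by auto
  then have 3: "runs (rewind 8 ?P) ?m3 (2 * length z + 5) ?m4"
    using runs_rewind[of 8 ?m3 p Comma z "Comma # r" ?P] by simp
  from runs_Seq[OF 1 runs_Seq[OF 2 runs_Seq[OF 3 runs_put_mem[of c]]]] show ?thesis
    unfolding add_edge_def by (simp add: runs_mono)
qed

lemma runs_add_edges:
  assumes "Comma \<notin> set z" "length v \<le> length x" "length z \<le> length x"
  shows "runs (for_cells 3 (add_edge c))
     (mem t0 q u (mark [] x) t4 v b f (mark (p @ [Comma]) (z @ Comma # r)))
     (length x * (12 * length x + 24) + 7)
     (mem t0 (q @ concat (replicate (length x) (v @ z @ [Comma, c]))) u (mark [] x) t4 v b f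
       (mark (p @ [Comma]) (z @ Comma # r)))"
proof -
  let ?S = "\<lambda>i. mem t0 (q @ concat (replicate i (v @ z @ [Comma, c]))) u (mark [] x) t4 v b f
       (mark (p @ [Comma]) (z @ Comma # r))"
  have rep: "concat (replicate i a) @ a = concat (replicate (Suc i) a)" for i and a :: "letter list"
    by (induction i) auto
  have "runs (for_cells 3 (add_edge c)) ((?S 0)[3 := mark [] x])
     (length x * (6 * length v + 6 * length z + 19 + 5) + 7) ((?S (length x))[3 := mark [] x])"
  proof (rule runs_for_cells[where k = 9])
    fix i
    let ?t = "mark (take i x) (drop i x)"
    show "runs (add_edge c) ((?S i)[3 := ?t]) (6 * length v + 6 * length z + 19) ((?S (Suc i))[3 := ?t])"
      using runs_add_edge[OF assms(1), of c t0 "q @ concat (replicate i (v @ z @ [Comma, c]))"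
          u ?t t4 v b f p r]
      by (simp only: append_assoc mem_update flip: rep)
  qed simp_all
  moreover have "length x * (6 * length v + 6 * length z + 19 + 5) + 7
      \<le> length x * (12 * length x + 24) + 7"
    using assms by simp
  ultimately show ?thesis by (simp add: runs_mono)
qed

lemma runs_ask_vertex:
  assumes "Comma \<notin> set z" "length v \<le> length x" "length z \<le> length x"
  shows "runs ask_vertex (mem t0 q u (mark [] x) t4 v b f (mark (p @ [Comma]) (z @ Comma # r)))
     (length x * (12 * length x + 24) + 17)
     (mem t0 (q @ concat (replicate (length x) (v @ z @ [Comma, Minus])) @ question) u (mark [] x) t4
       v b f (mark (p @ [Comma]) (z @ Comma # r)))"
  unfolding ask_vertex_def
  using runs_SeqI[OF runs_add_edges[OF assms] runs_put_question] by simp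

lemma runs_next_vertex:
  assumes "Comma \<notin> set z" "Semicolon \<notin> set z" "length v \<le> length x" "length z \<le> length x"
  shows "runs next_vertex (mem t0 q u (mark [] x) t4 v b f (mark p (Comma # z @ Comma # r)))
     (length x * (12 * length x + 24) + 20)
     (mem t0 (q @ concat (replicate (length x) (v @ z @ [Comma, Minus])) @ question) u (mark [] x) t4
       v b f (mark (p @ [Comma]) (z @ Comma # r)))"
proof -
  let ?m = "mem t0 q u (mark [] x) t4 v b f (mark (p @ [Comma]) (z @ Comma # r))"
  have 1: "runs (move 8 MoveR) (mem t0 q u (mark [] x) t4 v b f (mark p (Comma # z @ Comma # r))) 1 ?m"
    using runs_move_right[of "mem t0 q u (mark [] x) t4 v b f (mark p (Comma # z @ Comma # r))" 8] by simp
  have "scanned ?m 8 \<noteq> Letter Semicolon"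
    using assms(2) by (cases z) (auto simp: scanned_mem)
  from runs_Seq[OF 1 runs_CondF[where P = "\<lambda>x. x = Letter Semicolon" and a = finish,
        OF this runs_ask_vertex[OF assms(1,3,4)]]]
  show ?thesis unfolding next_vertex_def by (rule runs_mono) simp
qed

lemma runs_next_vertex_finish:
  "runs next_vertex (mem t0 q u t3 t4 v b [Plus] (mark p (Comma # Semicolon # r)))
     (6 * length b + 16)
     (mem t0 q (u @ [Semicolon] @ b @ [Semicolon]) t3 t4 v b [Semicolon]
       (mark (p @ [Comma]) (Semicolon # r)))"
proof -
  let ?t = "mark (p @ [Comma]) (Semicolon # r)"
  have 1: "runs (move 8 MoveR) (mem t0 q u t3 t4 v b [Plus] (mark p (Comma # Semicolon # r))) 1
      (mem t0 q u t3 t4 v b [Plus] ?t)"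
    using runs_move_right[of "mem t0 q u t3 t4 v b [Plus] (mark p (Comma # Semicolon # r))" 8] by simp
  have 2: "runs (put Semicolon 2) (mem t0 q u' t3 t4 v b [Plus] ?t) 1
      (mem t0 q (u' @ [Semicolon]) t3 t4 v b [Plus] ?t)" for u'
    using runs_put[of "mem t0 q u' t3 t4 v b [Plus] ?t" 2] by simp
  let ?m = "mem t0 q (u @ [Semicolon]) t3 t4 v b [Plus] ?t"
  have 3: "runs (rewind 6 (\<lambda>x. x \<noteq> Blank)) ?m (2 * length b + 5) (?m[6 := mark [] b])"
    using runs_rewind_blank[of 6 ?m b "[]"] by simp
  have 5: "runs (copy_while 6 (\<lambda>x. x \<noteq> Blank) id 2) (?m[6 := mark [] b]) (4 * length b + 1)
      (mem t0 q (u @ [Semicolon] @ b) t3 t4 v b [Plus] ?t)"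
    using runs_copy_while[of 6 2 "?m[6 := mark [] b]" "[]" b "[]" "u @ [Semicolon]" "\<lambda>x. x \<noteq> Blank" id]
    by simp
  have 4: "runs (store Semicolon 7) (mem t0 q u' t3 t4 v b [Plus] ?t) 1
      (mem t0 q u' t3 t4 v b [Semicolon] ?t)" for u'
    using runs_store[of "mem t0 q u' t3 t4 v b [Plus] ?t" 7 "[Plus]"] by simp
  have "runs finish (mem t0 q u t3 t4 v b [Plus] ?t) (6 * length b + 13)
      (mem t0 q (u @ [Semicolon] @ b @ [Semicolon]) t3 t4 v b [Semicolon] ?t)"
    unfolding finish_def
    using runs_Seq[OF 2 runs_Seq[OF 3 runs_Seq[OF 5 runs_Seq[OF 2 4]]]] by (simp add: add.commute)
  then have "runs (Cond 8 (\<lambda>x. x = Letter Semicolon) finish ask_vertex) (mem t0 q u t3 t4 v b [Plus] ?t)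
      (Suc (6 * length b + 13)) (mem t0 q (u @ [Semicolon] @ b @ [Semicolon]) t3 t4 v b [Semicolon] ?t)"
    by (intro runs_CondT) (auto simp: scanned_mem)
  from runs_Seq[OF 1 this] show ?thesis unfolding next_vertex_def by (simp add: add.commute)
qed

text \<open>A generous common bound for one call of either handler in either phase. It depends on
  the input length only, not on the length of the query.\<close>

definition round_time :: "nat \<Rightarrow> nat" where
  "round_time n = 100 * (n + 1)\<^sup>2"

section \<open>The handlers in the two phases\<close>

lemma runs_yes_search:
  assumes "Comma \<notin> set z" "length v \<le> length x" "length z \<le> length x"
  shows "runs yes_handler
     (mem t0 (q @ question) u (mark [] x) t4 v b [] (mark (p @ [Comma]) (z @ Comma # r)))
     (round_time (length x))
     (mem t0 (q @ concat (replicate (length x) (v @ z @ [Comma, Minus])) @ question) u (mark [] x) t4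
       v b [Plus] (mark (p @ [Comma]) (z @ Comma # r)))"
proof -
  let ?m = "mem t0 q u (mark [] x) t4 v b [] (mark (p @ [Comma]) (z @ Comma # r))"
  have 1: "runs (store Plus 7) ?m 1
     (mem t0 q u (mark [] x) t4 v b [Plus] (mark (p @ [Comma]) (z @ Comma # r)))"
    using runs_store[of ?m 7 "[]" Plus] by simp
  have "scanned ?m 7 = Blank" by (simp add: scanned_mem)
  from runs_Seq[OF runs_erase_question runs_CondT[where P = "\<lambda>x. x = Blank"
        and b = "copy_through 8 Comma 2 ;; next_vertex",
        OF this runs_Seq[OF 1 runs_ask_vertex[OF assms]]]]
  show ?thesis unfolding yes_handler_def
    by (rule runs_mono) (simp add: round_time_def power2_eq_square algebra_simps)
qed

lemma runs_no_search:
  assumes "Semicolon \<notin> set e" "length e \<le> n"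
  shows "runs no_handler
     (mem (mark (p @ [Semicolon]) (e @ Semicolon # r)) (q @ question) u t3 t4 v b [] t8) (round_time n)
     (mem (mark (p @ [Semicolon]) (e @ Semicolon # r)) (q @ map to_plus e @ question) u t3 t4 v b [] t8)"
proof -
  let ?t = "mark (p @ [Semicolon]) (e @ Semicolon # r)"
  have "runs (append_edges to_plus ;; put_question) (mem ?t q u t3 t4 v b [] t8) (6 * n + 17)
      (mem ?t ((q @ map to_plus e) @ question) u t3 t4 v b [] t8)"
    using assms(2) by (intro runs_SeqI[OF runs_append_edges[OF assms(1)] runs_put_question]) simp
  moreover have "scanned (mem ?t q u t3 t4 v b [] t8) 7 = Blank" by (simp add: scanned_mem)
  ultimately have "runs no_handler (mem ?t (q @ question) u t3 t4 v b [] t8) (round_time n)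
      (mem ?t ((q @ map to_plus e) @ question) u t3 t4 v b [] t8)"
    unfolding no_handler_def
    by (intro runs_SeqI[OF runs_erase_question runs_CondT])
      (auto simp: round_time_def power2_eq_square algebra_simps)
  then show ?thesis by simp
qed

lemma runs_yes_prefix:
  assumes "Comma \<notin> set z" "length z \<le> n"
    and "runs next_vertex (mem t0 q (u @ z @ [Comma]) t3 t4 v b [Plus] (mark (p @ z) (Comma # r)))
      (n * (12 * n + 24) + 20) m'"
  shows "runs yes_handler (mem t0 (q @ question) u t3 t4 v b [Plus] (mark p (z @ Comma # r)))
    (round_time n) m'"
proof -
  let ?m = "mem t0 q u t3 t4 v b [Plus] (mark p (z @ Comma # r))"
  have 1: "runs (copy_through 8 Comma 2) ?m (4 * length z + 3)
      (mem t0 q (u @ z @ [Comma]) t3 t4 v b [Plus] (mark (p @ z) (Comma # r)))"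
    using runs_copy_through[of 8 2 ?m p z Comma r u] assms(1) by simp
  have "scanned ?m 7 \<noteq> Blank" by (simp add: scanned_mem)
  from runs_Seq[OF runs_erase_question runs_CondF[where P = "\<lambda>x. x = Blank"
        and a = "store Plus 7 ;; ask_vertex", OF this runs_Seq[OF 1 assms(3)]]]
  show ?thesis unfolding yes_handler_def
    by (rule runs_mono) (use assms(2) in \<open>simp add: round_time_def power2_eq_square algebra_simps\<close>)
qed

lemma runs_no_prefix:
  assumes "Comma \<notin> set z" "length v \<le> length x" "length z \<le> length x"
    and "runs next_vertex (mem t0 (q @ concat (replicate (length x) (v @ z @ [Comma, Plus]))) u
        (mark [] x) t4 v (b @ z @ [Comma]) [Plus] (mark (p @ Comma # z) (Comma # r)))
      (length x * (12 * length x + 24) + 20) m'"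
  shows "runs no_handler
    (mem t0 (q @ question) u (mark [] x) t4 v b [Plus] (mark (p @ [Comma]) (z @ Comma # r)))
    (round_time (length x)) m'"
proof -
  let ?m = "mem t0 q u (mark [] x) t4 v b [Plus] (mark (p @ [Comma]) (z @ Comma # r))"
  let ?q = "q @ concat (replicate (length x) (v @ z @ [Comma, Plus]))"
  let ?m' = "mem t0 ?q u (mark [] x) t4 v b [Plus] (mark (p @ [Comma]) (z @ Comma # r))"
  have 1: "runs (copy_through 8 Comma 6) ?m' (4 * length z + 3)
      (mem t0 ?q u (mark [] x) t4 v (b @ z @ [Comma]) [Plus] (mark (p @ Comma # z) (Comma # r)))"
    using runs_copy_through[of 8 6 ?m' "p @ [Comma]" z Comma r b] assms(1) by simp
  have "scanned ?m 7 \<noteq> Blank" by (simp add: scanned_mem)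
  from runs_Seq[OF runs_erase_question runs_CondF[where P = "\<lambda>x. x = Blank"
        and a = "append_edges to_plus ;; put_question",
        OF this runs_Seq[OF runs_add_edges[OF assms(1-3)] runs_Seq[OF 1 assms(4)]]]]
  show ?thesis unfolding no_handler_def
    by (rule runs_mono) (use assms(3) in \<open>simp add: round_time_def power2_eq_square algebra_simps\<close>)
qed

lemma runs_append_edges_both:
  assumes "Semicolon \<notin> set e" "length e \<le> length x"
  shows "runs (for_cells 3 (for_cells 4 (append_edges to_minus ;; append_edges id)))
     (mem (mark (p @ [Semicolon]) (e @ Semicolon # r)) q u (mark [] x) (mark [] x) v b f t8)
     (length x * (length x * (12 * length x + 20) + 12) + 7)
     (mem (mark (p @ [Semicolon]) (e @ Semicolon # r))
       (q @ concat (replicate (length x * length x) (map to_minus e @ e))) u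
       (mark [] x) (mark [] x) v b f t8)"
proof -
  let ?n = "length x"
  let ?a = "map to_minus e @ e"
  let ?m = "\<lambda>i t3 t4. mem (mark (p @ [Semicolon]) (e @ Semicolon # r)) (q @ concat (replicate i ?a)) u
       t3 t4 v b f t8"
  have rep: "concat (replicate i a) @ a = concat (replicate (Suc i) a)" for i and a :: "letter list"
    by (induction i) auto
  have body: "runs (append_edges to_minus ;; append_edges id) (?m i t3 t4) (12 * ?n + 15)
      (?m (Suc i) t3 t4)" for i t3 t4
  proof -
    have "runs (append_edges to_minus ;; append_edges id) (?m i t3 t4) (12 * ?n + 15)
      (mem (mark (p @ [Semicolon]) (e @ Semicolon # r))
        (((q @ concat (replicate i ?a)) @ map to_minus e) @ map id e) u t3 t4 v b f t8)"
      by (rule runs_SeqI[OF runs_append_edges runs_append_edges]) (use assms in auto)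
    then show ?thesis by (simp only: append_assoc list.map_id id_def[symmetric] rep flip: rep)
  qed
  have inner: "runs (for_cells 4 (append_edges to_minus ;; append_edges id)) (?m j t3 (mark [] x))
      (?n * (12 * ?n + 20) + 7) (?m (j + ?n) t3 (mark [] x))" for j t3
  proof -
    have "runs (for_cells 4 (append_edges to_minus ;; append_edges id)) ((?m (j + 0) t3 (mark [] x))[4 := mark [] x])
      (?n * (12 * ?n + 15 + 5) + 7) ((?m (j + ?n) t3 (mark [] x))[4 := mark [] x])"
      by (rule runs_for_cells[where k = 9]) (use body in simp_all)
    then show ?thesis by (simp add: add.commute)
  qed
  have "runs (for_cells 3 (for_cells 4 (append_edges to_minus ;; append_edges id)))
      ((?m (0 * ?n) (mark [] x) (mark [] x))[3 := mark [] x])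
      (?n * (?n * (12 * ?n + 20) + 7 + 5) + 7)
      ((?m (?n * ?n) (mark [] x) (mark [] x))[3 := mark [] x])"
  \<comment> \<open>One round of the outer loop is a complete inner loop and adds \<open>?n\<close>
    copies, hence the index \<open>i * ?n\<close>.\<close>
  proof (rule runs_for_cells[where k = 9 and S = "\<lambda>i. ?m (i * ?n) (mark [] x) (mark [] x)"])
    fix i
    have "Suc i * ?n = i * ?n + ?n" by simp
    then show "runs (for_cells 4 (append_edges to_minus ;; append_edges id))
        ((?m (i * ?n) (mark [] x) (mark [] x))[3 := mark (take i x) (drop i x)])
        (?n * (12 * ?n + 20) + 7)
        ((?m (Suc i * ?n) (mark [] x) (mark [] x))[3 := mark (take i x) (drop i x)])"
      using inner[of "i * ?n" "mark (take i x) (drop i x)"] by (simp add: add.commute)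
  qed simp_all
  then show ?thesis by (simp add: add.commute)
qed

lemma runs_init_prefix:
  assumes x: "x = z @ Comma # r" "Comma \<notin> set z"
    and "runs (Cond 8 (\<lambda>x. x = Letter Semicolon) (store Semicolon 7) prepare)
      (mem (mark [] x) [] [] (mark [] x) (mark [] x) (z @ [Comma]) [] [] (mark (z @ [Comma]) r)) T m'"
  shows "runs init (mem (mark [] x) [] [] (mark [] []) (mark [] []) [] [] [] (mark [] []))
    (30 * length x + 60 + T) m'"
proof -
  let ?x = "mark [] x" and ?e = "mark [] [] :: letter tape"
  let ?z = "z @ [Comma]" and ?B = "\<lambda>x. x \<noteq> Blank"
  note a = runs_append_word[where w = x and u = "[]" and s = 0]
  note w = runs_rewind_blank[where z = x and r = "[]"]
  have 1: "runs (append_word 0 3) (mem ?x [] [] ?e ?e [] [] [] ?e) (6 * length x + 7)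
      (mem ?x [] [] (mark x []) ?e [] [] [] ?e)"
    using a[of 3 "mem ?x [] [] ?e ?e [] [] [] ?e"] by simp
  have 2: "runs (rewind 3 ?B) (mem ?x [] [] (mark x []) ?e [] [] [] ?e) (2 * length x + 5)
      (mem ?x [] [] ?x ?e [] [] [] ?e)"
    using w[of 3 "mem ?x [] [] (mark x []) ?e [] [] [] ?e"] by simp
  have 3: "runs (append_word 0 4) (mem ?x [] [] ?x ?e [] [] [] ?e) (6 * length x + 7)
      (mem ?x [] [] ?x (mark x []) [] [] [] ?e)"
    using a[of 4 "mem ?x [] [] ?x ?e [] [] [] ?e"] by simp
  have 4: "runs (rewind 4 ?B) (mem ?x [] [] ?x (mark x []) [] [] [] ?e) (2 * length x + 5)
      (mem ?x [] [] ?x ?x [] [] [] ?e)"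
    using w[of 4 "mem ?x [] [] ?x (mark x []) [] [] [] ?e"] by simp
  have 5: "runs (append_word 0 8) (mem ?x [] [] ?x ?x [] [] [] ?e) (6 * length x + 7)
      (mem ?x [] [] ?x ?x [] [] [] (mark x []))"
    using a[of 8 "mem ?x [] [] ?x ?x [] [] [] ?e"] by simp
  have 6: "runs (rewind 8 ?B) (mem ?x [] [] ?x ?x [] [] [] (mark x [])) (2 * length x + 5)
      (mem ?x [] [] ?x ?x [] [] [] ?x)"
    using w[of 8 "mem ?x [] [] ?x ?x [] [] [] (mark x [])"] by simp
  let ?m = "(mem ?x [] [] ?x ?x [] [] [] (mark z (Comma # r)))[5 := mark ?z []]"
  have 7: "runs (copy_through 8 Comma 5) (mem ?x [] [] ?x ?x [] [] [] ?x) (4 * length z + 3) ?m"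
    using runs_copy_through[of 8 5 "mem ?x [] [] ?x ?x [] [] [] ?x" "[]" z Comma r "[]"] x by simp
  have 8: "runs (rewind 5 ?B) ?m (2 * length ?z + 5)
      (mem ?x [] [] ?x ?x ?z [] [] (mark z (Comma # r)))"
    using runs_rewind_blank[of 5 ?m ?z "[]"] by simp
  have 9: "runs (move 8 MoveR) (mem ?x [] [] ?x ?x ?z [] [] (mark z (Comma # r))) 1
      (mem ?x [] [] ?x ?x ?z [] [] (mark ?z r))"
    using runs_move_right[of "mem ?x [] [] ?x ?x ?z [] [] (mark z (Comma # r))" 8] by simp
  have len: "Suc (length z) \<le> length x" using x by simp
  from runs_Seq[OF 1 runs_Seq[OF 2 runs_Seq[OF 3 runs_Seq[OF 4 runs_Seq[OF 5 runs_Seq[OF 6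
    runs_Seq[OF 7 runs_Seq[OF 8 runs_Seq[OF 9 assms(3)]]]]]]]]]
  show ?thesis unfolding init_def by (rule runs_mono) (use len in simp)
qed

lemma runs_init_single:
  assumes x: "x = z @ Comma # Semicolon # r" "Comma \<notin> set z"
  shows "runs init (mem (mark [] x) [] [] (mark [] []) (mark [] []) [] [] [] (mark [] []))
    (100 * (length x + 1) ^ 3)
    (mem (mark [] x) [] [] (mark [] x) (mark [] x) (z @ [Comma]) [] [Semicolon]
      (mark (z @ [Comma]) (Semicolon # r)))"
proof -
  let ?m = "mem (mark [] x) [] [] (mark [] x) (mark [] x) (z @ [Comma]) [] []
      (mark (z @ [Comma]) (Semicolon # r))"
  have "runs (Cond 8 (\<lambda>x. x = Letter Semicolon) (store Semicolon 7) prepare) ?m (Suc 1)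
      (mem (mark [] x) [] [] (mark [] x) (mark [] x) (z @ [Comma]) [] [Semicolon]
        (mark (z @ [Comma]) (Semicolon # r)))"
    using runs_store[of ?m 7 "[]" Semicolon] by (intro runs_CondT) (auto simp: scanned_mem)
  from runs_init_prefix[OF assms this] show ?thesis
    by (rule runs_mono) (simp add: power3_eq_cube algebra_simps)
qed

lemma runs_init:
  assumes x: "x = z @ Comma # r" "Comma \<notin> set z" "head_cell r \<noteq> Letter Semicolon"
    and x': "x = w @ Semicolon # e @ Semicolon # r'" "Semicolon \<notin> set w" "Semicolon \<notin> set e"
  shows "runs init (mem (mark [] x) [] [] (mark [] []) (mark [] []) [] [] [] (mark [] []))
    (100 * (length x + 1) ^ 3)
    (mem (mark (w @ [Semicolon]) (e @ Semicolon # r'))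
      (w @ [Semicolon] @ concat (replicate (length x * length x) (map to_minus e @ e)) @
        map to_plus e @ question)
      (z @ [Comma]) (mark [] x) (mark [] x) (z @ [Comma]) [] [] (mark (z @ [Comma]) r))"
proof -
  let ?x = "mark [] x" and ?z = "z @ [Comma]" and ?n = "length x"
  let ?t = "mark (z @ [Comma]) r"
  let ?h = "mark (w @ [Semicolon]) (e @ Semicolon # r')"
  let ?q = "concat (replicate (?n * ?n) (map to_minus e @ e))"
  have 1: "runs (append_word 5 2) (mem ?x [] [] ?x ?x ?z [] [] ?t) (6 * length ?z + 7)
      (mem ?x [] ?z ?x ?x ?z [] [] ?t)"
    using runs_append_word[of 5 2 "mem ?x [] [] ?x ?x ?z [] [] ?t" ?z "[]"] by simp
  let ?m = "mem (mark w (Semicolon # e @ Semicolon # r')) (w @ [Semicolon]) ?z ?x ?x ?z [] [] ?t"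
  have 2: "runs (copy_through 0 Semicolon 1) (mem ?x [] ?z ?x ?x ?z [] [] ?t) (4 * length w + 3) ?m"
    using runs_copy_through[of 0 1 "mem ?x [] ?z ?x ?x ?z [] [] ?t" "[]" w Semicolon
        "e @ Semicolon # r'" "[]"] x' by simp
  have 3: "runs (move 0 MoveR) ?m 1 (mem ?h (w @ [Semicolon]) ?z ?x ?x ?z [] [] ?t)"
    using runs_move_right[of ?m 0] by simp
  have len: "length z + 1 \<le> ?n" "length w \<le> ?n" "length e \<le> ?n"
    using arg_cong[OF x(1), of length] arg_cong[OF x'(1), of length] by simp_all
  have prep: "runs prepare (mem ?x [] [] ?x ?x ?z [] [] ?t)
      (Suc (6 * length ?z + 7 + Suc (4 * length w + 3 + Suc (1 +
        Suc ((?n * (?n * (12 * ?n + 20) + 12) + 7) + Suc (6 * length e + 7 + 9))))))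
      (mem ?h (w @ [Semicolon] @ ?q @ map to_plus e @ question) ?z ?x ?x ?z [] [] ?t)"
    unfolding prepare_def
    using runs_Seq[OF 1 runs_Seq[OF 2 runs_Seq[OF 3 runs_Seq[OF
      runs_append_edges_both[OF x'(3) len(3)]
      runs_Seq[OF runs_append_edges[OF x'(3)] runs_put_question]]]]]
    by (simp only: append_assoc)
  have "scanned (mem ?x [] [] ?x ?x ?z [] [] ?t) 8 \<noteq> Letter Semicolon"
    using x(3) by (simp add: scanned_mem)
  from runs_init_prefix[OF x(1,2) runs_CondF[where P = "\<lambda>x. x = Letter Semicolon"
      and a = "store Semicolon 7", OF this prep]]
  show ?thesis
    by (rule runs_mono) (use len in \<open>simp add: power3_eq_cube algebra_simps\<close>)
qed

section \<open>Encodings and cuts\<close>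

lemma append_marker_inject:
  "c \<notin> set xs \<Longrightarrow> c \<notin> set ys \<Longrightarrow> xs @ c # r = ys @ c # s \<longleftrightarrow> xs = ys \<and> r = s"
proof (induction xs arbitrary: ys)
  case Nil
  then show ?case by (cases ys) auto
next
  case (Cons a xs)
  then show ?case by (cases ys) auto
qed

lemma set_binary: "set (binary n) \<subseteq> {Bit0, Bit1}"
proof (induction n rule: binary.induct)
  case (1 n)
  then show ?case by (subst binary.simps) auto
qed

fun binary_value :: "letter list \<Rightarrow> nat" where
  "binary_value [] = 0"
| "binary_value (c # cs) = (if c = Bit1 then 1 else 0) + 2 * binary_value cs"

lemma binary_value_binary: "binary_value (binary n) = n"
proof (induction n rule: binary.induct)
  case (1 n)
  then show ?case by (subst binary.simps) auto
qed

lemma not_in_binary [simp]: "Comma \<notin> set (binary n)" "Semicolon \<notin> set (binary n)"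
    "Plus \<notin> set (binary n)" "Minus \<notin> set (binary n)"
  using set_binary[of n] by auto

lemma enc_nat_append_inject: "enc_nat a @ r = enc_nat b @ s \<longleftrightarrow> a = b \<and> r = s"
proof
  assume "enc_nat a @ r = enc_nat b @ s"
  then have "binary a = binary b \<and> r = s"
    using append_marker_inject[of Comma "binary a" "binary b" r s] by (simp add: enc_nat_def)
  then show "a = b \<and> r = s" by (metis binary_value_binary)
qed simp

lemma enc_nat_neq_Semicolon: "enc_nat a @ r \<noteq> Semicolon # s" "Semicolon # s \<noteq> enc_nat a @ r"
  using set_binary[of a] by (cases "binary a"; auto simp: enc_nat_def)+

lemma enc_vertices_simps:
  "enc_vertices [] = [Semicolon]" "enc_vertices (v # vs) = enc_nat v @ enc_vertices vs"
  by (simp_all add: enc_vertices_def)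

lemma enc_vertices_append_inject: "enc_vertices vs @ r = enc_vertices ws @ s \<longleftrightarrow> vs = ws \<and> r = s"
proof
  show "enc_vertices vs @ r = enc_vertices ws @ s \<Longrightarrow> vs = ws \<and> r = s"
  proof (induction vs arbitrary: ws)
    case Nil
    then show ?case
      by (cases ws) (auto simp: enc_vertices_simps enc_nat_neq_Semicolon)
  next
    case (Cons v vs)
    then show ?case
      by (cases ws) (auto simp: enc_vertices_simps enc_nat_append_inject enc_nat_neq_Semicolon)
  qed
qed simp

definition enc_edges :: "(nat \<times> nat \<times> int) list \<Rightarrow> letter list" where
  "enc_edges es = concat (map enc_edge es)"

lemma enc_edges_simps [simp]:
  "enc_edges [] = []" "enc_edges (e # es) = enc_edge e @ enc_edges es"
  "enc_edges (es @ es') = enc_edges es @ enc_edges es'"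
  "enc_edges (concat (replicate k es)) = concat (replicate k (enc_edges es))"
  "enc_edges (replicate k e) = concat (replicate k (enc_edge e))"
  by (simp_all add: enc_edges_def) (induction k; simp)+

lemma enc_sign_inject: "v \<in> {-1, 1} \<Longrightarrow> w \<in> {-1, 1} \<Longrightarrow> enc_sign v = enc_sign w \<Longrightarrow> v = w"
  by (auto simp: enc_sign_def)

text \<open>Only the sign of a weight is written down, so decoding relies on the weights being -1 or
  1.\<close>

lemma enc_edges_inject:
  assumes "enc_edges es @ Semicolon # r = enc_edges es' @ Semicolon # s"
    "\<forall>(u, v, w)\<in>set es. w \<in> {-1, 1}" "\<forall>(u, v, w)\<in>set es'. w \<in> {-1, 1}"
  shows "es = es' \<and> r = s"
  using assms
proof (induction es arbitrary: es')
  case Nil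
  then show ?case
    by (cases es') (auto simp: enc_nat_neq_Semicolon)
next
  case (Cons e es)
  obtain u v w where e: "e = (u, v, w)" by (cases e) auto
  show ?case
  proof (cases es')
    case Nil
    then show ?thesis using Cons.prems by (auto simp: e enc_nat_neq_Semicolon)
  next
    case (Cons e' es'')
    obtain u' v' w' where e': "e' = (u', v', w')" by (cases e') auto
    have "u = u' \<and> v = v' \<and> enc_sign w = enc_sign w' \<and>
        enc_edges es @ Semicolon # r = enc_edges es'' @ Semicolon # s"
      using Cons.prems(1) by (simp add: e e' Cons enc_nat_append_inject)
    moreover have "w = w'" using calculation Cons.prems(2,3)
      by (intro enc_sign_inject) (auto simp: e e' Cons)
    ultimately show ?thesis using Cons.IH[of es''] Cons.prems(2,3) by (auto simp: e e' Cons)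
  qed
qed

lemma enc_rat_zero: "Semicolon # enc_rat 0 = question"
proof -
  have "binary 0 = []" "binary 1 = [Bit1]" by (simp_all add: binary.simps)
  then show ?thesis by (simp add: enc_rat_def question_def enc_nat_def enc_sign_def)
qed

lemma enc_rat_eq_zero: "enc_rat k = enc_rat 0 \<Longrightarrow> k = 0"
proof -
  assume eq: "enc_rat k = enc_rat 0"
  obtain a b where ab: "quotient_of k = (a, b)" by fastforce
  have "enc_nat (nat \<bar>a\<bar>) @ enc_nat (nat b) = enc_nat 0 @ enc_nat 1"
    using eq ab by (simp add: enc_rat_def)
  then have "a = 0" by (simp add: enc_nat_append_inject)
  then show "k = 0" using quotient_of_div[OF ab] by simp
qed

section \<open>Cut weights as additive functions of edge lists\<close>

definition signed_cut :: "'v set \<Rightarrow> ('v \<times> 'v \<times> int) list \<Rightarrow> int" where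
  "signed_cut A es = (\<Sum>(u, v, w)\<leftarrow>es. if (u \<in> A) \<noteq> (v \<in> A) then w else 0)"

text \<open>With \<open>c = 1\<close>, \<open>signed_cut\<close> counts the edges of a cut.
  Numerator and denominator of an average are thus values of the same additive function.\<close>

definition reweight :: "int \<Rightarrow> ('v \<times> 'v \<times> int) list \<Rightarrow> ('v \<times> 'v \<times> int) list" where
  "reweight c es = map (\<lambda>(u, v, w). (u, v, c)) es"

lemma signed_cut_simps [simp]:
  "signed_cut A [] = 0"
  "signed_cut A ((u, v, w) # es) = (if (u \<in> A) \<noteq> (v \<in> A) then w else 0) + signed_cut A es"
  "signed_cut A (es @ es') = signed_cut A es + signed_cut A es'"
  by (simp_all add: signed_cut_def)

lemma signed_cut_replicate [simp]:
  "signed_cut A (concat (replicate k es)) = int k * signed_cut A es"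
  "signed_cut A (replicate k (u, v, w)) = (if (u \<in> A) \<noteq> (v \<in> A) then int k * w else 0)"
  by (induction k) (auto simp: algebra_simps)

lemma signed_cut_reweight: "signed_cut A (reweight c es) = c * signed_cut A (reweight 1 es)"
  by (induction es) (auto simp: reweight_def algebra_simps)

lemma signed_cut_reweight_bounds:
  "0 \<le> signed_cut A (reweight 1 es)" "signed_cut A (reweight 1 es) \<le> int (length es)"
  by (induction es) (auto simp: reweight_def)

lemma abs_signed_cut_le:
  "\<forall>(u, v, w)\<in>set es. w \<in> {-1, 1} \<Longrightarrow> \<bar>signed_cut A es\<bar> \<le> signed_cut A (reweight 1 es)"
  by (induction es) (auto simp: reweight_def)

lemma signed_cut_compl:
  "\<forall>(u, v, w)\<in>set es. u \<in> V \<and> v \<in> V \<Longrightarrow> signed_cut (V - A) es = signed_cut A es"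
  by (induction es) auto

section \<open>Graphs presented by lists, and their cuts\<close>

lemma multigraph_graph_of:
  "multigraph (graph_of vs es) \<longleftrightarrow>
     vs \<noteq> [] \<and> (\<forall>(u, v, w)\<in>set es. u \<in> set vs \<and> v \<in> set vs \<and> u \<noteq> v \<and> w \<in> {-1, 1})"
proof -
  have card: "card {u, v} = 2 \<longleftrightarrow> u \<noteq> v" for u v :: nat
    by (auto simp: card_insert_if)
  show ?thesis
    by (auto simp: multigraph_def graph_of_def all_set_conv_all_nth case_prod_unfold card)
qed

lemma multigraph_weights:
  "multigraph (graph_of vs es) \<Longrightarrow> \<forall>(u, v, w)\<in>set es. w \<in> {-1, 1}"
  by (fastforce simp: multigraph_graph_of)

text \<open>Since there are no loops, meeting \<open>A\<close> in exactly one vertex is the same as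
  having the two ends on different sides. The function \<open>f\<close> is arbitrary in order to
  cover both the weight and the size of a cut.\<close>

lemma sum_cut:
  assumes "multigraph (graph_of vs es)"
  shows "(\<Sum>i\<in>cut (graph_of vs es) A. f (es ! i)) =
    (\<Sum>(u, v, w)\<leftarrow>es. if (u \<in> A) \<noteq> (v \<in> A) then f (u, v, w) else (0 :: int))"
proof -
  have card: "card ({u, v} \<inter> A) = 1 \<longleftrightarrow> (u \<in> A) \<noteq> (v \<in> A)" if "u \<noteq> v" for u v :: nat
    using that by (auto simp: Int_insert_left)
  have "cut (graph_of vs es) A =
      {i \<in> {..<length es}. (fst (es ! i) \<in> A) \<noteq> (fst (snd (es ! i)) \<in> A)}"
  proof -
    have "fst (es ! i) \<noteq> fst (snd (es ! i))" if "i < length es" for i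
      using assms nth_mem[OF that] unfolding multigraph_graph_of by (auto simp: case_prod_unfold)
    then have "card ({fst (es ! i), fst (snd (es ! i))} \<inter> A) = 1 \<longleftrightarrow>
        (fst (es ! i) \<in> A) \<noteq> (fst (snd (es ! i)) \<in> A)" if "i < length es" for i
      using that by (intro card)
    then show ?thesis
      unfolding cut_def by (intro Collect_cong) (auto simp: graph_of_def case_prod_unfold)
  qed
  then have "(\<Sum>i\<in>cut (graph_of vs es) A. f (es ! i)) =
      (\<Sum>i<length es. if (fst (es ! i) \<in> A) \<noteq> (fst (snd (es ! i)) \<in> A) then f (es ! i) else 0)"
    by (simp only: sum.inter_filter finite_lessThan)
  also have "\<dots> = (\<Sum>(u, v, w)\<leftarrow>es. if (u \<in> A) \<noteq> (v \<in> A) then f (u, v, w) else 0)"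
    by (simp add: sum_list_sum_nth case_prod_unfold atLeast0LessThan cong: if_cong)
  finally show ?thesis .
qed

lemma cut_average_graph_of:
  assumes "multigraph (graph_of vs es)"
  shows "cut_average (graph_of vs es) A =
    of_int (signed_cut A es) / of_int (signed_cut A (reweight 1 es))"
proof -
  have "(\<Sum>i\<in>cut (graph_of vs es) A. weight (graph_of vs es) i) = signed_cut A es"
    using sum_cut[OF assms, of "\<lambda>e. snd (snd e)" A]
    by (simp add: signed_cut_def graph_of_def case_prod_unfold cong: if_cong)
  moreover have "int (card (cut (graph_of vs es) A)) = signed_cut A (reweight 1 es)"
    using sum_cut[OF assms, of "\<lambda>e. 1" A]
    by (simp add: signed_cut_def reweight_def comp_def case_prod_unfold cong: if_cong)
  ultimately show ?thesis
    unfolding cut_average_def by (metis of_int_of_nat_eq)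
qed

lemma nontrivial_partition_graph_of:
  "nontrivial_partition (graph_of vs es) A B \<longleftrightarrow>
     A \<noteq> {} \<and> A \<subset> set vs \<and> B = set vs - A"
  by (auto simp: nontrivial_partition_def graph_of_def)

lemma adjacent_graph_of: "adjacent (graph_of vs es) = {(a, b). \<exists>(u, v, w)\<in>set es. {u, v} = {a, b}}"
proof -
  have "set es = (!) es ` {..<length es}" by (auto simp: set_conv_nth)
  then show ?thesis by (simp add: adjacent_def graph_of_def case_prod_unfold)
qed

lemma connected_graph_of_mono:
  "connected_graph (graph_of vs es) \<Longrightarrow> set es \<subseteq> set es' \<Longrightarrow> connected_graph (graph_of vs es')"
proof -
  assume "connected_graph (graph_of vs es)" "set es \<subseteq> set es'"
  moreover have "adjacent (graph_of vs es) \<subseteq> adjacent (graph_of vs es')"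
    unfolding adjacent_graph_of using calculation(2) by blast
  then have "(adjacent (graph_of vs es))\<^sup>* \<subseteq> (adjacent (graph_of vs es'))\<^sup>*"
    by (rule rtrancl_mono)
  ultimately show ?thesis by (auto simp: connected_graph_def graph_of_def)
qed

text \<open>If no edge left \<open>A\<close>, every path starting in \<open>A\<close> would stay
  there, whereas connectedness provides a path to a vertex outside.\<close>

lemma connected_cut_pos:
  assumes "connected_graph (graph_of vs es)" "A \<noteq> {}" "A \<subset> set vs"
  shows "0 < signed_cut A (reweight 1 es)"
proof (rule ccontr)
  assume "\<not> ?thesis"
  then have "signed_cut A (reweight 1 es) = 0"
    using signed_cut_reweight_bounds(1)[of A es] by simp
  then have no: "(u \<in> A) = (v \<in> A)" if "(u, v, w) \<in> set es" for u v w
    using that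
  proof (induction es)
    case (Cons e es)
    then show ?case using signed_cut_reweight_bounds(1)[of A es]
      by (cases e) (auto simp: reweight_def split: if_splits)
  qed simp
  obtain a b where ab: "a \<in> A" "b \<in> set vs" "b \<notin> A" using assms by blast
  then have "(a, b) \<in> (adjacent (graph_of vs es))\<^sup>*"
    using assms by (auto simp: connected_graph_def graph_of_def)
  then have "b \<in> A"
  proof (induction rule: rtrancl_induct)
    case (step y z)
    then obtain u v w where "(u, v, w) \<in> set es" "{u, v} = {y, z}"
      by (auto simp: adjacent_graph_of)
    then show ?case using no[of u v w] step by (auto simp: doubleton_eq_iff)
  qed (use ab in simp)
  with ab show False by simp
qed

lemma question_in_MaxAvgCut:
  assumes "distinct vs" "multigraph (graph_of vs es)" "connected_graph (graph_of vs es)"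
  shows "enc_vertices vs @ enc_edges es @ question \<in> MaxAvgCut \<longleftrightarrow>
    (\<exists>A. A \<noteq> {} \<and> A \<subset> set vs \<and> 0 \<le> signed_cut A es)"
proof -
  have word: "enc_vertices vs @ enc_edges es @ question = enc_graph vs es @ enc_rat 0"
    by (simp add: enc_graph_def enc_edges_def flip: enc_rat_zero)
  have avg: "0 \<le> cut_average (graph_of vs es) A \<longleftrightarrow> 0 \<le> signed_cut A es" for A
  proof (cases "signed_cut A (reweight 1 es) = 0")
    case True
    \<comment> \<open>Division by zero makes the average 0 here. The numerator vanishes as well,
      being bounded by the size, so the signs still agree.\<close>
    then have "signed_cut A es = 0"
      using abs_signed_cut_le[OF multigraph_weights[OF assms(2)], of A] by simp
    with True show ?thesis by (simp add: cut_average_graph_of[OF assms(2)])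
  next
    case False
    then show ?thesis
      using signed_cut_reweight_bounds(1)[of A es]
      by (simp add: cut_average_graph_of[OF assms(2)] zero_le_divide_iff)
  qed
  have "enc_graph vs es @ enc_rat 0 \<in> MaxAvgCut \<longleftrightarrow>
      (\<exists>A B. nontrivial_partition (graph_of vs es) A B \<and> cut_average (graph_of vs es) A \<ge> 0)"
    (is "?L \<longleftrightarrow> ?R")
  proof
    assume ?R
    with assms show ?L unfolding MaxAvgCut_def
      by (intro CollectI exI[of _ vs] exI[of _ es] exI[of _ 0]) auto
  next
    assume ?L
    \<comment> \<open>A priori the word might be in the language because of another graph or
      threshold; unique readability excludes this.\<close>
    then obtain vs' es' k where *: "enc_graph vs es @ enc_rat 0 = enc_graph vs' es' @ enc_rat k"
      "multigraph (graph_of vs' es')"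
      "\<exists>A B. nontrivial_partition (graph_of vs' es') A B \<and> cut_average (graph_of vs' es') A \<ge> k"
      unfolding MaxAvgCut_def by blast
    have "vs = vs'" "enc_edges es @ Semicolon # enc_rat 0 = enc_edges es' @ Semicolon # enc_rat k"
      using *(1) by (simp_all add: enc_graph_def enc_edges_def enc_vertices_append_inject)
    moreover from this(2) have "es = es' \<and> enc_rat 0 = enc_rat k"
      using multigraph_weights assms(2) *(2) by (intro enc_edges_inject)
    ultimately show ?R using *(3) enc_rat_eq_zero[of k] by simp
  qed
  then show ?thesis
    unfolding word avg by (auto simp: nontrivial_partition_graph_of)
qed

lemma map_to_plus_enc_edges: "map to_plus (enc_edges es) = enc_edges (reweight 1 es)"
proof -
  have "map to_plus (binary n) = binary n" for n
    using set_binary[of n] by (intro map_idI) (auto simp: to_plus_def)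
  then show ?thesis
    by (induction es) (auto simp: reweight_def enc_nat_def enc_sign_def to_plus_def)
qed

lemma map_to_minus_enc_edges: "map to_minus (enc_edges es) = enc_edges (reweight (-1) es)"
proof -
  have "map to_minus (binary n) = binary n" for n
    using set_binary[of n] by (intro map_idI) (auto simp: to_minus_def)
  then show ?thesis
    by (induction es) (auto simp: reweight_def enc_nat_def enc_sign_def to_minus_def)
qed

lemma Semicolon_notin_enc_edges: "Semicolon \<notin> set (enc_edges es)"
  by (induction es) (auto simp: enc_nat_def enc_sign_def split: if_splits)

lemma length_enc_edges: "length es \<le> length (enc_edges es)"
  by (induction es) (auto simp: enc_nat_def)

section \<open>Correctness of the queries\<close>

abbreviation vertex_text :: "nat list \<Rightarrow> letter list" where
  "vertex_text us \<equiv> concat (map enc_nat us)"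

locale cut_instance =
  fixes v0 :: nat and ws :: "nat list" and es :: "(nat \<times> nat \<times> int) list"
  assumes distinct: "distinct (v0 # ws)" and ws: "ws \<noteq> []"
    and multigraph: "multigraph (graph_of (v0 # ws) es)"
    and connected: "connected_graph (graph_of (v0 # ws) es)"
begin

abbreviation "vs \<equiv> v0 # ws"

definition "x = enc_graph vs es"

definition "n = length x"

definition splits :: "nat set \<Rightarrow> bool" where
  "splits A \<longleftrightarrow> A \<noteq> {} \<and> A \<subset> set vs"

definition base :: "nat \<Rightarrow> (nat \<times> nat \<times> int) list" where
  "base a = concat (replicate (n * n) (reweight (-1) es @ es)) @ concat (replicate a (reweight 1 es))"

abbreviation "cut_size A \<equiv> signed_cut A (reweight 1 es)"

definition admissible :: "(nat \<times> nat \<times> int) list \<Rightarrow> bool" where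
  "admissible E \<longleftrightarrow> (\<forall>(u, v, w)\<in>set E. u \<in> set vs \<and> v \<in> set vs \<and> u \<noteq> v \<and> w \<in> {-1, 1})"

lemma x_eq: "x = vertex_text vs @ Semicolon # enc_edges es @ [Semicolon]"
  by (simp add: x_def enc_graph_def enc_vertices_def enc_edges_def)

text \<open>Strict because the word also contains vertices and delimiters. This keeps every cut size
  strictly below \<open>n\<close>.\<close>

lemma length_es: "length es < n"
  using length_enc_edges[of es] by (simp add: n_def x_eq)

lemma length_ws: "length ws < n"
proof -
  have "length us \<le> length (vertex_text us)" for us
    by (induction us) (auto simp: enc_nat_def)
  from this[of ws] show ?thesis by (simp add: n_def x_eq)
qed

lemma length_enc_nat_le_n: "w \<in> set vs \<Longrightarrow> length (enc_nat w) \<le> n"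
proof -
  have "w \<in> set us \<Longrightarrow> length (enc_nat w) \<le> length (vertex_text us)" for us
    by (induction us) auto
  from this[of vs] show "w \<in> set vs \<Longrightarrow> length (enc_nat w) \<le> n" by (simp add: n_def x_eq)
qed

text \<open>The difference \<open>cut_size A - signed_cut A es\<close> is twice the number of
  negative edges in the cut. For a nonempty cut, a nonnegative value thus says that 1 minus its
  average is at most a / n^2.\<close>

lemma signed_cut_base: "signed_cut A (base a) = int a * cut_size A - int (n * n) * (cut_size A - signed_cut A es)"
  using signed_cut_reweight[of A "-1" es] by (simp add: base_def algebra_simps)

lemma cut_size_pos: "splits A \<Longrightarrow> 0 < cut_size A"
  using connected_cut_pos[OF connected] by (simp add: splits_def)

lemma cut_size_less: "cut_size A < int n"
  using signed_cut_reweight_bounds(2)[of A es] length_es by simp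

lemma abs_cut_le_size: "\<bar>signed_cut A es\<bar> \<le> cut_size A"
  using abs_signed_cut_le[OF multigraph_weights[OF multigraph]] .

lemma admissible_es: "admissible es"
  using multigraph unfolding admissible_def multigraph_graph_of by (rule conjunct2)

lemma admissible_append [simp]: "admissible (E @ F) \<longleftrightarrow> admissible E \<and> admissible F"
  unfolding admissible_def set_append by (rule ball_Un)

lemma admissible_base: "admissible (base a)"
  using admissible_es by (auto simp: admissible_def base_def reweight_def)

lemma admissible_replicate: "w \<in> set ws \<Longrightarrow> c \<in> {-1, 1} \<Longrightarrow> admissible (replicate k (v0, w, c))"
  using distinct by (auto simp: admissible_def)

lemma n_pos: "0 < n"
  using length_es by simp

lemma oracle_base:
  assumes "admissible E"
  shows "enc_vertices vs @ enc_edges (base a @ E) @ question \<in> MaxAvgCut \<longleftrightarrow>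
    (\<exists>A. splits A \<and> 0 \<le> signed_cut A (base a) + signed_cut A E)"
proof -
  have "multigraph (graph_of vs (base a @ E))"
  proof -
    have "admissible (base a @ E)" using assms admissible_base by simp
    then show ?thesis by (simp only: multigraph_graph_of admissible_def) simp
  qed
  \<comment> \<open>As \<open>n\<close> is positive, \<open>base a\<close> contains
    \<open>es\<close> itself, and connectedness is inherited.\<close>
  moreover have "connected_graph (graph_of vs (base a @ E))"
    by (rule connected_graph_of_mono[OF connected]) (use n_pos in \<open>auto simp: base_def\<close>)
  ultimately have "enc_vertices vs @ enc_edges (base a @ E) @ question \<in> MaxAvgCut \<longleftrightarrow>
      (\<exists>A. A \<noteq> {} \<and> A \<subset> set vs \<and> 0 \<le> signed_cut A (base a @ E))"
    by (rule question_in_MaxAvgCut[OF distinct])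
  then show ?thesis by (simp only: splits_def conj_assoc signed_cut_simps(3))
qed

section \<open>The least level with a positive answer\<close>

definition level :: nat where
  "level = (LEAST a. 1 \<le> a \<and> (\<exists>A. splits A \<and> 0 \<le> signed_cut A (base a)))"

lemma splits_v0: "splits {v0}"
  using distinct hd_in_set[OF ws] by (auto simp: splits_def)

lemma level:
  "1 \<le> level" "\<exists>A. splits A \<and> 0 \<le> signed_cut A (base level)" "level \<le> 2 * (n * n)"
proof -
  let ?P = "\<lambda>a. 1 \<le> a \<and> (\<exists>A. splits A \<and> 0 \<le> signed_cut A (base a))"
  \<comment> \<open>At this value of \<open>a\<close> every cut passes, since its weight is n^2
    times size plus signed weight and the latter is at least minus the size. Any split would do as a
    witness.\<close>
  have "signed_cut {v0} (base (2 * (n * n))) = int (n * n) * (cut_size {v0} + signed_cut {v0} es)"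
    by (simp add: signed_cut_base algebra_simps)
  moreover have "0 \<le> cut_size {v0} + signed_cut {v0} es"
    using abs_cut_le_size[of "{v0}"] by linarith
  ultimately have P: "?P (2 * (n * n))"
    using splits_v0 n_pos by (auto intro!: exI[of _ "{v0}"] simp: Suc_le_eq)
  show "1 \<le> level" "\<exists>A. splits A \<and> 0 \<le> signed_cut A (base level)"
    using LeastI[of ?P, OF P] by (simp_all add: level_def)
  show "level \<le> 2 * (n * n)"
    unfolding level_def by (rule Least_le[of ?P, OF P])
qed

text \<open>Above level 1 this is the failure of the preceding query. At level 1 the left side
  vanishes and the right side is nonnegative, so the search may start at 1 although 0 is never
  asked.\<close>

lemma below_level:
  assumes "splits A"
  shows "int (level - 1) * cut_size A \<le> int (n * n) * (cut_size A - signed_cut A es)"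
proof (cases "level = 1")
  case True
  then show ?thesis using abs_cut_le_size[of A] by simp
next
  case False
  let ?P = "\<lambda>a. 1 \<le> a \<and> (\<exists>A. splits A \<and> 0 \<le> signed_cut A (base a))"
  have "level - 1 < Least ?P" using level(1) unfolding level_def by linarith
  then have "\<not> ?P (level - 1)" by (rule not_less_Least)
  moreover have "1 \<le> level - 1" using False level(1) by simp
  ultimately have "\<not> 0 \<le> signed_cut A (base (level - 1))" using assms by blast
  then show ?thesis by (simp add: signed_cut_base)
qed

text \<open>The last positive copy raises a weight that was at most 0 by the size of the cut, which
  is below \<open>n\<close>.\<close>

lemma base_level_less: "splits A \<Longrightarrow> signed_cut A (base level) < int n"
proof -
  assume A: "splits A"
  obtain k where "level = Suc k" using level(1) by (cases level) auto
  then have "signed_cut A (base level) \<le> cut_size A"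
    using below_level[OF A] by (simp add: signed_cut_base algebra_simps)
  then show ?thesis using cut_size_less[of A] by simp
qed

text \<open>Two different ratios with denominators below \<open>n\<close> differ by more than \<open>1 / n\<^sup>2\<close>, hence they
  cannot both lie between consecutive levels.\<close>

lemma base_level_optimal:
  assumes A: "splits A" "0 \<le> signed_cut A (base level)" and B: "splits B"
  shows "cut_average (graph_of vs es) B \<le> cut_average (graph_of vs es) A"
proof -
  define lA lB where "lA = cut_size A - signed_cut A es" "lB = cut_size B - signed_cut B es"
  have pos: "0 < cut_size A" "0 < cut_size B" using A B cut_size_pos by auto
  have le: "lA * cut_size B \<le> lB * cut_size A"
  proof (rule ccontr)
    assume "\<not> lA * cut_size B \<le> lB * cut_size A"
    then have "int (n * n) * 1 \<le> int (n * n) * (lA * cut_size B - lB * cut_size A)"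
      by (intro mult_left_mono) auto
    also have "\<dots> = (int (n * n) * lA) * cut_size B - (int (n * n) * lB) * cut_size A"
      by (simp add: algebra_simps)
    \<comment> \<open>\<open>A\<close> passes at \<open>level\<close>, while \<open>B\<close> at
      best ties at \<open>level - 1\<close>; this bounds the two products from opposite
      sides.\<close>
    also have "\<dots> \<le> (int level * cut_size A) * cut_size B - (int (level - 1) * cut_size B) * cut_size A"
      using A(2) below_level[OF B] pos
      by (intro diff_mono mult_right_mono) (auto simp: signed_cut_base lA_lB_def)
    also have "\<dots> = (int level - int (level - 1)) * (cut_size A * cut_size B)"
      by (simp add: algebra_simps)
    also have "\<dots> = cut_size A * cut_size B"
      using level(1) by simp
    also have "\<dots> < int n * int n"
      using cut_size_less pos n_pos by (intro mult_strict_mono) auto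
    finally show False by simp
  qed
  have "signed_cut B es * cut_size A \<le> signed_cut A es * cut_size B"
    using le by (simp add: lA_lB_def algebra_simps)
  then have "rat_of_int (signed_cut B es) * rat_of_int (cut_size A)
      \<le> rat_of_int (signed_cut A es) * rat_of_int (cut_size B)"
    by (metis of_int_le_iff of_int_mult)
  then show ?thesis
    using pos by (simp add: cut_average_graph_of[OF multigraph] divide_simps mult.commute)
qed

section \<open>Determining one optimal partition vertex by vertex\<close>

definition good :: "nat list \<Rightarrow> nat set \<Rightarrow> bool" where
  "good us A \<longleftrightarrow> splits A \<and> v0 \<in> A \<and> set us \<subseteq> A \<and> 0 \<le> signed_cut A (base level)"

text \<open>\<open>ds\<close> are the vertices tested so far, \<open>us\<close> the accepted and
  \<open>bs\<close> the rejected ones, and \<open>E\<close> are the edges added to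
  \<open>base level\<close>. Rejected vertices leave no trace in cut weights; the last clause keeps
  them outside every remaining good set.\<close>

definition invariant :: "(nat \<times> nat \<times> int) list \<Rightarrow> nat list \<Rightarrow> nat list \<Rightarrow> nat list \<Rightarrow> bool" where
  "invariant E us bs ds \<longleftrightarrow> admissible E \<and>
     (\<forall>A. v0 \<in> A \<longrightarrow> signed_cut A E = - int n * int (length (filter (\<lambda>u. u \<notin> A) us))) \<and>
     set us \<union> set bs = set ds \<and> distinct us \<and> distinct bs \<and>
     (\<exists>A. good us A) \<and> (\<forall>b\<in>set bs. \<forall>A. good us A \<longrightarrow> b \<notin> A)"

text \<open>A set and its complement have the same cut, so the side containing \<open>v0\<close> may
  be chosen.\<close>

lemma normalise_side:
  assumes "splits A" "admissible E" "0 \<le> signed_cut A (base level) + signed_cut A E"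
  obtains A' where "splits A'" "v0 \<in> A'" "0 \<le> signed_cut A' (base level) + signed_cut A' E"
proof (cases "v0 \<in> A")
  case True
  then show ?thesis using assms that by blast
next
  case False
  have "signed_cut (set vs - A) F = signed_cut A F" if "admissible F" for F
    by (rule signed_cut_compl) (use that in \<open>auto simp: admissible_def\<close>)
  moreover have "splits (set vs - A)" using assms(1) by (auto simp: splits_def)
  ultimately show ?thesis
    using that[of "set vs - A"] False assms admissible_base by auto
qed

lemma exists_good: "\<exists>A. good [] A"
proof -
  obtain A where "splits A" "0 \<le> signed_cut A (base level)" using level(2) by blast
  then have "0 \<le> signed_cut A (base level) + signed_cut A []" by simp
  moreover have "admissible []" by (simp add: admissible_def)
  ultimately obtain A' where "splits A'" "v0 \<in> A'" "0 \<le> signed_cut A' (base level) + signed_cut A' []"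
    using normalise_side[OF \<open>splits A\<close>] by blast
  then show ?thesis by (auto simp: good_def)
qed

lemma invariantD:
  assumes "invariant E us bs ds"
  shows "admissible E" "v0 \<in> A \<Longrightarrow> signed_cut A E = - int n * int (length (filter (\<lambda>u. u \<notin> A) us))"
    "set us \<union> set bs = set ds" "distinct us" "distinct bs" "\<exists>A. good us A"
    "b \<in> set bs \<Longrightarrow> good us A \<Longrightarrow> b \<notin> A"
  using assms unfolding invariant_def by blast+

text \<open>Each vertex of \<open>us @ [w]\<close> separated from \<open>v0\<close> costs
  \<open>n\<close>, more than the weight of any cut in \<open>base level\<close>. A cut of
  nonnegative total weight therefore separates none of them, and the added edges contribute 0 to
  it.\<close>

lemma oracle_vertex:
  assumes inv: "invariant E us bs ds" and w: "w \<in> set ws"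
  shows "enc_vertices vs @ enc_edges (base level @ E @ replicate n (v0, w, -1)) @ question \<in> MaxAvgCut
    \<longleftrightarrow> (\<exists>A. good (us @ [w]) A)"
proof -
  let ?E = "E @ replicate n (v0, w, -1)"
  have adm: "admissible ?E"
    using inv w admissible_replicate by (simp add: invariant_def)
  have cutE: "signed_cut A ?E = - int n * int (length (filter (\<lambda>u. u \<notin> A) (us @ [w])))" if "v0 \<in> A" for A
    using invariantD(2)[OF inv that] that by (simp add: algebra_simps)
  have "(\<exists>A. splits A \<and> 0 \<le> signed_cut A (base level) + signed_cut A ?E) \<longleftrightarrow> (\<exists>A. good (us @ [w]) A)"
  proof
    assume "\<exists>A. good (us @ [w]) A"
    then obtain A where A: "good (us @ [w]) A" by blast
    then have "filter (\<lambda>u. u \<notin> A) (us @ [w]) = []"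
      by (auto simp: good_def filter_empty_conv)
    then have "signed_cut A ?E = 0" using cutE[of A] A by (simp only: good_def) simp
    moreover have "splits A" "0 \<le> signed_cut A (base level)"
      using A by (simp_all add: good_def)
    ultimately show "\<exists>A. splits A \<and> 0 \<le> signed_cut A (base level) + signed_cut A ?E"
      by (intro exI[of _ A] conjI) linarith+
  next
    assume "\<exists>A. splits A \<and> 0 \<le> signed_cut A (base level) + signed_cut A ?E"
    then obtain A0 where A0: "splits A0" "0 \<le> signed_cut A0 (base level) + signed_cut A0 ?E" by blast
    obtain A where A: "splits A" "v0 \<in> A" "0 \<le> signed_cut A (base level) + signed_cut A ?E"
      by (rule normalise_side[OF A0(1) adm A0(2)])
    let ?k = "int (length (filter (\<lambda>u. u \<notin> A) (us @ [w])))"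
    have "int n * ?k < int n * 1"
      using A(3) cutE[OF A(2)] base_level_less[OF A(1)] by simp
    then have "?k < 1" by (rule mult_left_less_imp_less) simp
    then have "?k = 0" by linarith
    moreover from this have "signed_cut A ?E = 0"
      unfolding cutE[OF A(2)] by simp
    ultimately have "0 \<le> signed_cut A (base level)" "set (us @ [w]) \<subseteq> A"
      using A(3) by (linarith, simp only: of_nat_eq_0_iff length_0_conv filter_empty_conv, blast)
    then show "\<exists>A. good (us @ [w]) A" using A(1,2) by (auto simp: good_def)
  qed
  then show ?thesis using oracle_base[OF adm, of level] by simp
qed

lemma good_antimono: "good (us @ [w]) A \<Longrightarrow> good us A"
  by (auto simp: good_def)

lemma invariant_yes:
  assumes inv: "invariant E us bs ds" and w: "w \<in> set ws" "w \<notin> set ds"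
    and good: "\<exists>A. good (us @ [w]) A"
  shows "invariant (E @ replicate n (v0, w, -1)) (us @ [w]) bs (ds @ [w])"
  unfolding invariant_def
proof (intro conjI allI impI ballI)
  show "admissible (E @ replicate n (v0, w, -1))"
    using inv admissible_replicate[OF w(1)] by (simp add: invariant_def)
  show "signed_cut A (E @ replicate n (v0, w, -1)) =
      - int n * int (length (filter (\<lambda>u. u \<notin> A) (us @ [w])))" if "v0 \<in> A" for A
    using invariantD(2)[OF inv that] that by (simp add: algebra_simps)
  show "b \<notin> A" if "b \<in> set bs" "good (us @ [w]) A" for b A
    using invariantD(7)[OF inv that(1)] good_antimono[OF that(2)] by blast
qed (use invariantD(3-5)[OF inv] w good in auto)

text \<open>The two bundles of \<open>n\<close> edges cancel in every cut. A good set for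
  \<open>us\<close> that contained \<open>w\<close> would be good for \<open>us @ [w]\<close>,
  contrary to the negative answer.\<close>

lemma invariant_no:
  assumes inv: "invariant E us bs ds" and w: "w \<in> set ws" "w \<notin> set ds"
    and good: "\<not> (\<exists>A. good (us @ [w]) A)"
  shows "invariant (E @ replicate n (v0, w, -1) @ replicate n (v0, w, 1)) us (bs @ [w]) (ds @ [w])"
  unfolding invariant_def
proof (intro conjI allI impI ballI)
  show "admissible (E @ replicate n (v0, w, -1) @ replicate n (v0, w, 1))"
    using inv admissible_replicate[OF w(1)] by (simp add: invariant_def)
  show "signed_cut A (E @ replicate n (v0, w, -1) @ replicate n (v0, w, 1)) =
      - int n * int (length (filter (\<lambda>u. u \<notin> A) us))" if "v0 \<in> A" for A
    using invariantD(2)[OF inv that] that by (simp add: algebra_simps)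
  show "b \<notin> A" if "b \<in> set (bs @ [w])" "good us A" for b A
  proof (cases "b \<in> set bs")
    case True
    then show ?thesis using invariantD(7)[OF inv True] that by blast
  next
    case False
    then have "b = w" using that by simp
    then show ?thesis using good that(2) by (auto simp: good_def)
  qed
qed (use invariantD(3-6)[OF inv] w in auto)

text \<open>Once every vertex is accepted or rejected, a good set contains \<open>us\<close> and
  avoids \<open>bs\<close>, so it can only be \<open>set (v0 # us)\<close>. A good set exists by the
  invariant and is optimal by \<open>base_level_optimal\<close>.\<close>

lemma invariant_final:
  assumes "invariant E us bs ws"
  shows "max_average_partition (graph_of vs es) (set (v0 # us)) (set bs)" "distinct (v0 # us)" "distinct bs"
proof -
  note inv = invariantD[OF assms]
  obtain A where A: "good us A" using inv(6) by blast
  then have sub: "v0 \<in> A" "set us \<subseteq> A" "A \<subset> set vs" "splits A" "0 \<le> signed_cut A (base level)"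
    by (simp_all add: good_def splits_def)
  have bs: "set bs \<inter> A = {}" using inv(7) A by blast
  have A_eq: "A = set (v0 # us)" using sub(1-3) bs inv(3) by auto
  have bs_eq: "set bs = set vs - A" using bs sub(1,2) inv(3) by auto
  show "max_average_partition (graph_of vs es) (set (v0 # us)) (set bs)"
    unfolding A_eq[symmetric] bs_eq max_average_partition_def nontrivial_partition_graph_of
    using sub base_level_optimal[OF sub(4,5)] by (auto simp: splits_def)
  show "distinct (v0 # us)" "distinct bs"
    using inv(3-5) distinct by auto
qed

end

section \<open>The run of the machine\<close>

lemma reaches_runs:
  assumes "c \<in> {init, yes_handler, no_handler}" "runs c ts T ts'" "length ts = 9"
  shows "reduction.reaches L (reduction.code (Run [c]), ts) (Suc T)
    (reduction.code (if scanned ts' 7 = Letter Semicolon then Stop else Ask), ts')"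
proof -
  obtain m where m: "m \<le> T" "exec c ts m ts'" using assms(2) by (auto simp: runs_def)
  show ?thesis
    by (rule reduction.reaches_mono[OF reduction.reaches_handler[OF assms(1) m(2) assms(3)]])
      (use m(1) in simp)
qed

lemma reaches_round:
  assumes "ts ! 1 = mark q []" "length ts = 9"
    and "runs (if q \<in> L then yes_handler else no_handler) ts T ts'"
  shows "reduction.reaches L (reduction.code Ask, ts) (T + 2)
    (reduction.code (if scanned ts' 7 = Letter Semicolon then Stop else Ask), ts')"
proof -
  have "fst (ts ! 1) = content q" using assms(1) by (simp add: mark_def)
  from reduction.reaches_trans[OF reduction.reaches_query[OF this]
      reaches_runs[OF _ assms(3,2)]]
  have "reduction.reaches L (reduction.code Ask, ts) (1 + Suc T)
    (reduction.code (if scanned ts' 7 = Letter Semicolon then Stop else Ask), ts')"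
    by simp
  then show ?thesis by (rule reduction.reaches_mono) simp
qed

context cut_instance
begin

abbreviation "rest_text \<equiv> Semicolon # enc_edges es @ [Semicolon]"

abbreviation "edge_tape \<equiv> mark (vertex_text vs @ [Semicolon]) (enc_edges es @ [Semicolon])"

definition search_mem :: "nat \<Rightarrow> letter tape list" where
  "search_mem a = mem edge_tape (enc_vertices vs @ enc_edges (base a) @ question) (enc_nat v0)
     (mark [] x) (mark [] x) (enc_nat v0) [] [] (mark (enc_nat v0) (vertex_text ws @ rest_text))"

definition split_mem :: "(nat \<times> nat \<times> int) list \<Rightarrow> nat list \<Rightarrow> nat list \<Rightarrow> nat list \<Rightarrow> nat \<Rightarrow> nat list \<Rightarrow>
    letter tape list" where
  "split_mem E us bs ds w rs = mem edge_tape
     (enc_vertices vs @ enc_edges (base level @ E @ replicate n (v0, w, -1)) @ question)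
     (vertex_text (v0 # us)) (mark [] x) (mark [] x) (enc_nat v0) (vertex_text bs) [Plus]
     (mark (vertex_text (v0 # ds)) (vertex_text (w # rs) @ rest_text))"

text \<open>One name for both outcomes of a round, the final memory if no vertex is left and the
  next query otherwise, so that each handler needs a single statement.\<close>

fun next_mem :: "(nat \<times> nat \<times> int) list \<Rightarrow> nat list \<Rightarrow> nat list \<Rightarrow> nat list \<Rightarrow> nat list \<Rightarrow>
    letter tape list" where
  "next_mem E us bs ds [] = mem edge_tape (enc_vertices vs @ enc_edges (base level @ E))
     (enc_vertices (v0 # us) @ enc_vertices bs) (mark [] x) (mark [] x) (enc_nat v0) (vertex_text bs)
     [Semicolon] (mark (vertex_text (v0 # ds)) rest_text)"
| "next_mem E us bs ds (w # rs) = split_mem E us bs ds w rs"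

lemma length_vertex_le: "w \<in> set vs \<Longrightarrow> length (binary w) \<le> length x" "length (enc_nat v0) \<le> length x"
  using length_enc_nat_le_n[of w] length_enc_nat_le_n[of v0] by (auto simp: enc_nat_def n_def)

text \<open>Fewer than \<open>n\<close> vertices, each written with at most \<open>n\<close>
  letters. The bound fits the final copying of tape 6 into the quadratic time of a round.\<close>

lemma length_bs:
  assumes "distinct bs" "set bs \<subseteq> set ws"
  shows "length (vertex_text bs) \<le> n * n"
proof -
  have "length (vertex_text us) \<le> length us * n" if "set us \<subseteq> set ws" for us
    using that
  proof (induction us)
    case (Cons u us)
    then show ?case using length_enc_nat_le_n[of u] by simp
  qed simp
  moreover have "length bs \<le> length ws"
    using assms distinct_card[of bs] distinct_card[of ws] distinct card_mono[of "set ws" "set bs"]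
    by simp
  ultimately show ?thesis
    using assms(2) length_ws by (meson le_trans less_imp_le mult_le_mono1)
qed

lemma runs_next:
  assumes "distinct bs" "set bs \<subseteq> set ws" "set rs \<subseteq> set ws"
  shows "runs next_vertex (mem edge_tape (enc_vertices vs @ enc_edges (base level @ E))
      (vertex_text (v0 # us)) (mark [] x) (mark [] x) (enc_nat v0) (vertex_text bs) [Plus]
      (mark (vertex_text (v0 # ds) @ binary w) (Comma # vertex_text rs @ rest_text)))
    (n * (12 * n + 24) + 20) (next_mem E us bs (ds @ [w]) rs)"
proof (cases rs)
  case Nil
  let ?q = "enc_vertices vs @ enc_edges (base level @ E)"
  have "runs next_vertex (mem edge_tape ?q (vertex_text (v0 # us)) (mark [] x) (mark [] x)
      (enc_nat v0) (vertex_text bs) [Plus]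
      (mark (vertex_text (v0 # ds) @ binary w) (Comma # vertex_text rs @ rest_text)))
      (6 * length (vertex_text bs) + 16) (next_mem E us bs (ds @ [w]) rs)"
    using runs_next_vertex_finish[of edge_tape ?q "vertex_text (v0 # us)" "mark [] x" "mark [] x"
        "enc_nat v0" "vertex_text bs" "vertex_text (v0 # ds) @ binary w" "enc_edges es @ [Semicolon]"]
    by (simp add: Nil enc_vertices_def enc_nat_def)
  moreover have "6 * length (vertex_text bs) + 16 \<le> n * (12 * n + 24) + 20"
    using length_bs[OF assms(1,2)] by (simp add: algebra_simps)
  ultimately show ?thesis by (rule runs_mono)
next
  case (Cons w' rs')
  have "w' \<in> set vs" using assms(3) Cons by simp
  then show ?thesis
    using runs_next_vertex[of "binary w'" "enc_nat v0" x edge_tape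
        "enc_vertices vs @ enc_edges (base level @ E)" "vertex_text (v0 # us)" "mark [] x"
        "vertex_text bs" "[Plus]" "vertex_text (v0 # ds) @ binary w" "vertex_text rs' @ rest_text"]
      length_vertex_le(1)[of w'] length_vertex_le(2)
    by (simp add: Cons split_mem_def enc_nat_def enc_sign_def n_def)
qed

lemma split_round:
  assumes inv: "invariant E us bs ds" and ws_eq: "ws = ds @ w # rs"
  obtains E' us' bs' where "invariant E' us' bs' (ds @ [w])"
    "reduction.reaches MaxAvgCut (reduction.code Ask, split_mem E us bs ds w rs) (round_time n + 2)
      (reduction.code (if rs = [] then Stop else Ask), next_mem E' us' bs' (ds @ [w]) rs)"
proof -
  let ?q = "enc_vertices vs @ enc_edges (base level @ E @ replicate n (v0, w, -1)) @ question"
  have w: "w \<in> set ws" "w \<notin> set ds" "w \<in> set vs" using ws_eq distinct by auto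
  have sub: "set ds \<subseteq> set ws" "set rs \<subseteq> set ws" using ws_eq by auto
  have flag: "(if scanned (next_mem E' us' bs' (ds @ [w]) rs) 7 = Letter Semicolon then Stop else Ask)
      = (if rs = [] then Stop else Ask)" for E' us' bs'
    by (cases rs) (simp_all add: scanned_mem split_mem_def)
  have nth: "split_mem E us bs ds w rs ! 1 = mark ?q []" by (simp add: split_mem_def)
  have len9: "length (split_mem E us bs ds w rs) = 9" by (simp add: split_mem_def)
  \<comment> \<open>The comma in front of the current vertex is where \<open>rewind\<close> stops on
    tape 8; it exists because \<open>v0\<close> always precedes.\<close>
  obtain p where p: "vertex_text (v0 # ds) = p @ [Comma]"
    by (induction ds rule: rev_induct) (auto simp: enc_nat_def)
  have len: "length (binary w) \<le> n" using length_vertex_le(1)[OF w(3)] by (simp add: n_def)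
  show ?thesis
  proof (cases "\<exists>A. good (us @ [w]) A")
    case True
    let ?E = "E @ replicate n (v0, w, -1)"
    have inv': "invariant ?E (us @ [w]) bs (ds @ [w])" by (rule invariant_yes[OF inv w(1,2) True])
    have "set bs \<subseteq> set ws" using invariantD(3)[OF inv] sub by auto
    from runs_next[OF invariantD(5)[OF inv] this sub(2), of ?E "us @ [w]" ds w]
    have "runs next_vertex (mem edge_tape (enc_vertices vs @ enc_edges (base level @ ?E))
        (vertex_text (v0 # us) @ binary w @ [Comma]) (mark [] x) (mark [] x) (enc_nat v0)
        (vertex_text bs) [Plus]
        (mark (vertex_text (v0 # ds) @ binary w) (Comma # vertex_text rs @ rest_text)))
      (n * (12 * n + 24) + 20) (next_mem ?E (us @ [w]) bs (ds @ [w]) rs)"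
      by (simp add: enc_nat_def)
    from runs_yes_prefix[OF not_in_binary(1) len this]
    have "runs yes_handler (split_mem E us bs ds w rs) (round_time n)
        (next_mem ?E (us @ [w]) bs (ds @ [w]) rs)"
      by (simp add: split_mem_def enc_nat_def)
    note r = this
    have yes: "?q \<in> MaxAvgCut" using oracle_vertex[OF inv w(1)] True by blast
    have "reduction.reaches MaxAvgCut (reduction.code Ask, split_mem E us bs ds w rs)
        (round_time n + 2)
        (reduction.code (if rs = [] then Stop else Ask), next_mem ?E (us @ [w]) bs (ds @ [w]) rs)"
      using reaches_round[OF nth len9, of MaxAvgCut "round_time n"
          "next_mem ?E (us @ [w]) bs (ds @ [w]) rs"] yes r
      by (simp only: flag if_True)
    then show ?thesis using that inv' by blast
  next
    case False
    let ?E = "E @ replicate n (v0, w, -1) @ replicate n (v0, w, 1)"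
    have inv': "invariant ?E us (bs @ [w]) (ds @ [w])" by (rule invariant_no[OF inv w(1,2) False])
    have "set (bs @ [w]) \<subseteq> set ws" using invariantD(3)[OF inv] sub w by auto
    from runs_next[OF invariantD(5)[OF inv'] this sub(2), of ?E us ds w]
    have "runs next_vertex (mem edge_tape ((enc_vertices vs @ enc_edges (base level @ E @ replicate n (v0, w, -1)))
          @ concat (replicate (length x) (enc_nat v0 @ binary w @ [Comma, Plus])))
        (vertex_text (v0 # us)) (mark [] x) (mark [] x) (enc_nat v0)
        (vertex_text bs @ binary w @ [Comma]) [Plus]
        (mark (p @ Comma # binary w) (Comma # vertex_text rs @ rest_text)))
      (length x * (12 * length x + 24) + 20) (next_mem ?E us (bs @ [w]) (ds @ [w]) rs)"
      unfolding p by (simp add: enc_nat_def enc_sign_def n_def)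
    from runs_no_prefix[OF not_in_binary(1) length_vertex_le(2) len[unfolded n_def] this]
    have "runs no_handler (split_mem E us bs ds w rs) (round_time n)
        (next_mem ?E us (bs @ [w]) (ds @ [w]) rs)"
      unfolding split_mem_def p by (simp add: enc_nat_def n_def)
    note r = this
    have no: "?q \<notin> MaxAvgCut" using oracle_vertex[OF inv w(1)] False by blast
    have "reduction.reaches MaxAvgCut (reduction.code Ask, split_mem E us bs ds w rs)
        (round_time n + 2)
        (reduction.code (if rs = [] then Stop else Ask), next_mem ?E us (bs @ [w]) (ds @ [w]) rs)"
      using reaches_round[OF nth len9, of MaxAvgCut "round_time n"
          "next_mem ?E us (bs @ [w]) (ds @ [w]) rs"] no r
      by (simp only: flag if_False)
    then show ?thesis using that inv' by blast
  qed
qed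

lemma split_phase:
  assumes "invariant E us bs ds" "ws = ds @ w # rs"
  obtains E' us' bs' where "invariant E' us' bs' ws"
    "reduction.reaches MaxAvgCut (reduction.code Ask, split_mem E us bs ds w rs)
      (length (w # rs) * (round_time n + 2)) (reduction.code Stop, next_mem E' us' bs' ws [])"
  using assms
proof (induction rs arbitrary: E us bs ds w thesis)
  case Nil
  obtain E' us' bs' where "invariant E' us' bs' (ds @ [w])"
    "reduction.reaches MaxAvgCut (reduction.code Ask, split_mem E us bs ds w []) (round_time n + 2)
      (reduction.code (if [] = ([] :: nat list) then Stop else Ask), next_mem E' us' bs' (ds @ [w]) [])"
    using split_round[OF Nil.prems(2,3)] by blast
  then show ?case using Nil.prems(1,3) by simp
next
  case (Cons w' rs)
  obtain E1 us1 bs1 where 1: "invariant E1 us1 bs1 (ds @ [w])"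
    "reduction.reaches MaxAvgCut (reduction.code Ask, split_mem E us bs ds w (w' # rs)) (round_time n + 2)
      (reduction.code (if w' # rs = [] then Stop else Ask), next_mem E1 us1 bs1 (ds @ [w]) (w' # rs))"
    using split_round[OF Cons.prems(2,3)] by blast
  have "ws = (ds @ [w]) @ w' # rs" using Cons.prems(3) by simp
  from Cons.IH[OF _ 1(1) this] obtain E' us' bs' where 2: "invariant E' us' bs' ws"
    "reduction.reaches MaxAvgCut (reduction.code Ask, split_mem E1 us1 bs1 (ds @ [w]) w' rs)
      (length (w' # rs) * (round_time n + 2)) (reduction.code Stop, next_mem E' us' bs' ws [])"
    by blast
  have "reduction.reaches MaxAvgCut (reduction.code Ask, split_mem E us bs ds w (w' # rs))
      (round_time n + 2 + length (w' # rs) * (round_time n + 2))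
      (reduction.code Stop, next_mem E' us' bs' ws [])"
    using 1(2) 2(2) by (intro reduction.reaches_trans[OF _ 2(2)]) simp
  then have "reduction.reaches MaxAvgCut (reduction.code Ask, split_mem E us bs ds w (w' # rs))
      (length (w # w' # rs) * (round_time n + 2)) (reduction.code Stop, next_mem E' us' bs' ws [])"
    by (rule reduction.reaches_mono) simp
  then show ?case using Cons.prems(1) 2(1) by blast
qed

lemma edge_tape_facts: "Semicolon \<notin> set (enc_edges es)" "length (enc_edges es) \<le> n"
  using Semicolon_notin_enc_edges by (auto simp: n_def x_eq)

lemma base_Suc: "enc_edges (base a) @ enc_edges (reweight 1 es) = enc_edges (base (Suc a))"
proof -
  have "concat (replicate a y) @ y = concat (replicate (Suc a) y)" for y :: "letter list"
    by (induction a) auto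
  then show ?thesis by (simp add: base_def)
qed

lemma search_phase:
  assumes "1 \<le> a" "a \<le> level"
  shows "reduction.reaches MaxAvgCut (reduction.code Ask, search_mem 1) ((a - 1) * (round_time n + 2))
    (reduction.code Ask, search_mem a)"
  using assms
proof (induction a rule: dec_induct)
  case base
  show ?case by (auto simp: reduction.reaches_def)
next
  case (step a)
  let ?q = "enc_vertices vs @ enc_edges (base a) @ question"
  \<comment> \<open>Every query before \<open>level\<close> is answered negatively, by
    minimality.\<close>
  have "\<not> (1 \<le> a \<and> (\<exists>A. splits A \<and> 0 \<le> signed_cut A (base a)))"
    using step.prems by (intro not_less_Least) (simp add: level_def)
  then have no: "?q \<notin> MaxAvgCut"
    using oracle_base[of "[]" a] step.hyps by (simp add: admissible_def)
  have "runs no_handler (search_mem a) (round_time n) (search_mem (Suc a))"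
    using runs_no_search[OF edge_tape_facts, of "vertex_text vs" "[]"
        "enc_vertices vs @ enc_edges (base a)"]
    by (simp add: search_mem_def map_to_plus_enc_edges flip: base_Suc)
  then have "reduction.reaches MaxAvgCut (reduction.code Ask, search_mem a) (round_time n + 2)
      (reduction.code (if scanned (search_mem (Suc a)) 7 = Letter Semicolon then Stop else Ask),
        search_mem (Suc a))"
    using no by (intro reaches_round[where q = ?q]) (simp_all add: search_mem_def)
  moreover have "scanned (search_mem (Suc a)) 7 \<noteq> Letter Semicolon"
    by (simp add: search_mem_def scanned_mem)
  ultimately have "reduction.reaches MaxAvgCut (reduction.code Ask, search_mem a) (round_time n + 2)
      (reduction.code Ask, search_mem (Suc a))"
    by (simp only: if_False)
  moreover have "reduction.reaches MaxAvgCut (reduction.code Ask, search_mem 1)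
      ((a - 1) * (round_time n + 2)) (reduction.code Ask, search_mem a)"
    by (rule step.IH) (use step.prems in simp)
  ultimately have "reduction.reaches MaxAvgCut (reduction.code Ask, search_mem 1)
      ((a - 1) * (round_time n + 2) + (round_time n + 2)) (reduction.code Ask, search_mem (Suc a))"
    by (blast intro: reduction.reaches_trans)
  moreover have "(a - 1) * (round_time n + 2) + (round_time n + 2) = (Suc a - 1) * (round_time n + 2)"
    using step.hyps by (cases a) auto
  ultimately show ?case by (simp only:)
qed

lemma search_end:
  assumes "ws = w # rs"
  shows "reduction.reaches MaxAvgCut (reduction.code Ask, search_mem level) (round_time n + 2)
    (reduction.code Ask, split_mem [] [] [] [] w rs)"
proof -
  let ?q = "enc_vertices vs @ enc_edges (base level) @ question"
  have yes: "?q \<in> MaxAvgCut"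
    using oracle_base[of "[]" level] level(2) by (simp add: admissible_def)
  have ws_text: "vertex_text ws @ rest_text = binary w @ Comma # vertex_text rs @ rest_text"
    by (simp add: assms enc_nat_def)
  have "w \<in> set vs" using assms by simp
  then have "runs yes_handler (search_mem level) (round_time n) (split_mem [] [] [] [] w rs)"
    using runs_yes_search[of "binary w" "enc_nat v0" x edge_tape
        "enc_vertices vs @ enc_edges (base level)" "enc_nat v0" "mark [] x" "[]" "binary v0"
        "vertex_text rs @ rest_text"] length_vertex_le(1)[of w] length_vertex_le(2)
    by (simp add: search_mem_def split_mem_def ws_text enc_nat_def enc_sign_def n_def)
  then have "reduction.reaches MaxAvgCut (reduction.code Ask, search_mem level) (round_time n + 2)
      (reduction.code (if scanned (split_mem [] [] [] [] w rs) 7 = Letter Semicolon then Stop else Ask),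
        split_mem [] [] [] [] w rs)"
    using yes by (intro reaches_round[where q = ?q]) (simp_all add: search_mem_def)
  then show ?thesis by (simp add: split_mem_def scanned_mem)
qed

lemma init_phase:
  "reduction.reaches L (initial_config reduction.machine x) (100 * (n + 1) ^ 3 + 1)
    (reduction.code Ask, search_mem 1)"
proof -
  obtain w rs where w: "ws = w # rs" using ws by (cases ws) auto
  let ?m = "mem (mark [] x) [] [] (mark [] []) (mark [] []) [] [] [] (mark [] [])"
  have m: "(content x, 0) # replicate (9 - 1) (content [], 0) = ?m"
    by (simp add: mem_def mark_def numeral_eq_Suc)
  have "Semicolon \<notin> set (vertex_text vs)" by (auto simp: enc_nat_def)
  moreover have "head_cell (vertex_text ws @ rest_text) \<noteq> Letter Semicolon"
    using not_in_binary(2)[of w] by (cases "binary w") (auto simp: w enc_nat_def)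
  moreover have "x = binary v0 @ Comma # vertex_text ws @ rest_text"
    by (simp add: x_eq enc_nat_def)
  ultimately have "runs init ?m (100 * (n + 1) ^ 3) (search_mem 1)"
    using runs_init[of x "binary v0" "vertex_text ws @ rest_text" "vertex_text vs" "enc_edges es" "[]"]
      Semicolon_notin_enc_edges x_eq
    by (simp add: search_mem_def base_def map_to_plus_enc_edges map_to_minus_enc_edges n_def
        enc_vertices_def enc_nat_def)
  from reaches_runs[OF _ this, of L] show ?thesis
    unfolding reduction.initial_config_machine m by (simp add: search_mem_def scanned_mem)
qed

lemma machine_solves:
  obtains us bs where
    "outputs_within reduction.machine MaxAvgCut x (500 * (n + 1) ^ 4) (enc_vertices us @ enc_vertices bs)"
    "distinct us" "distinct bs" "max_average_partition (graph_of vs es) (set us) (set bs)"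
proof -
  obtain w rs where w: "ws = w # rs" using ws by (cases ws) auto
  have "invariant [] [] [] []"
    using exists_good by (simp add: invariant_def admissible_def)
  moreover have "ws = [] @ w # rs" using w by simp
  ultimately obtain E us bs where inv: "invariant E us bs ws" and
    4: "reduction.reaches MaxAvgCut (reduction.code Ask, split_mem [] [] [] [] w rs)
      (length (w # rs) * (round_time n + 2)) (reduction.code Stop, next_mem E us bs ws [])"
    using split_phase by blast
  have 2: "reduction.reaches MaxAvgCut (reduction.code Ask, search_mem 1)
      ((level - 1) * (round_time n + 2)) (reduction.code Ask, search_mem level)"
    by (rule search_phase) (use level in auto)
  note reach = reduction.reaches_trans[OF init_phase reduction.reaches_trans[OF 2
      reduction.reaches_trans[OF search_end[OF w] 4]]]
  let ?R = "round_time n + 2"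
  have "(level - 1) * ?R + (?R + length (w # rs) * ?R) = (level - 1 + 1 + length ws) * ?R"
    by (simp add: w algebra_simps)
  \<comment> \<open>The rounds are \<open>level - 1\<close> failed searches, one successful search
    and one test for each vertex of \<open>ws\<close>: at most 2 n^2 + n in all.\<close>
  also have "\<dots> \<le> (3 * (n + 1)^2) * (102 * (n + 1)^2)"
    using level length_ws
    by (intro mult_mono) (auto simp: round_time_def power2_eq_square algebra_simps)
  also have "\<dots> = 306 * (n + 1) ^ 4"
    using power_add[of "n + 1" 2 2] by (simp only: numeral_plus_numeral) simp
  finally have "(level - 1) * ?R + (?R + length (w # rs) * ?R) \<le> 306 * (n + 1) ^ 4" .
  moreover have "(n + 1) ^ 3 \<le> (n + 1) ^ 4" by (rule power_increasing) auto
  moreover have "1 \<le> (n + 1) ^ 4" by simp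
  ultimately have "100 * (n + 1) ^ 3 + 1 + ((level - 1) * ?R + (?R + length (w # rs) * ?R))
      \<le> 500 * (n + 1) ^ 4"
    by linarith
  then have "outputs_within reduction.machine MaxAvgCut x (500 * (n + 1) ^ 4)
      (enc_vertices (v0 # us) @ enc_vertices bs)"
    using reach by (intro reduction.stop_outputs) (auto simp: mark_def)
  then show ?thesis using that invariant_final[OF inv] by blast
qed

end

section \<open>Instances with a single vertex, and the reduction\<close>

lemma single_vertex_no_solution:
  assumes "x = enc_graph [v] es"
  shows "solutions MaxAvgCutOpt x = {}"
proof -
  have False if "x = enc_graph vs es'" "max_average_partition (graph_of vs es') A B" for vs es' A B
  proof -
    have "vs = [v]"
      using assms that(1) by (simp add: enc_graph_def enc_vertices_append_inject)
    then show False
      using that(2) by (auto simp: max_average_partition_def nontrivial_partition_graph_of)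
  qed
  then show ?thesis by (auto simp: MaxAvgCutOpt_def)
qed

lemma machine_single_vertex:
  assumes "x = enc_graph [v] es"
  shows "outputs_within reduction.machine L x (500 * (length x + 1) ^ 4) []"
proof -
  let ?m = "mem (mark [] x) [] [] (mark [] []) (mark [] []) [] [] [] (mark [] [])"
  have m: "(content x, 0) # replicate (9 - 1) (content [], 0) = ?m"
    by (simp add: mem_def mark_def numeral_eq_Suc)
  have "x = binary v @ Comma # Semicolon # enc_edges es @ [Semicolon]"
    using assms by (simp add: enc_graph_def enc_vertices_def enc_nat_def enc_edges_def)
  from reaches_runs[OF _ runs_init_single[OF this], of L]
  have r: "reduction.reaches L (initial_config reduction.machine x) (Suc (100 * (length x + 1) ^ 3))
    (reduction.code Stop, mem (mark [] x) [] [] (mark [] x) (mark [] x) (binary v @ [Comma]) [] [Semicolon]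
      (mark (binary v @ [Comma]) (Semicolon # enc_edges es @ [Semicolon])))"
    unfolding reduction.initial_config_machine m by (simp add: scanned_mem)
  have "(length x + 1) ^ 3 \<le> (length x + 1) ^ 4" by (rule power_increasing) auto
  moreover have "1 \<le> (length x + 1) ^ 4" by simp
  ultimately have "Suc (100 * (length x + 1) ^ 3) \<le> 500 * (length x + 1) ^ 4" by linarith
  from reduction.stop_outputs[OF r this] show ?thesis by (simp add: mark_def)
qed

theorem theorem3: "poly_time_turing_reducible MaxAvgCutOpt MaxAvgCut"
proof -
  let ?p = "smult 500 ([:1, 1:] ^ 4) :: nat poly"
  have poly: "poly ?p k = 500 * (k + 1) ^ 4" for k by (simp add: poly_power)
  have "\<exists>y. outputs_within reduction.machine MaxAvgCut x (poly ?p (length x)) y \<and>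
      (if solutions MaxAvgCutOpt x = {} then y = [] else y \<in> solutions MaxAvgCutOpt x)"
    if x: "x \<in> instances MaxAvgCutOpt" for x
  proof -
    obtain vs es where g: "x = enc_graph vs es" "distinct vs" "simple_graph (graph_of vs es)"
      "connected_graph (graph_of vs es)"
      using x by (auto simp: MaxAvgCutOpt_def)
    then have mg: "multigraph (graph_of vs es)" by (simp add: simple_graph_def)
    then obtain v ws where vs: "vs = v # ws" by (cases vs) (auto simp: multigraph_graph_of)
    show ?thesis
    proof (cases "ws = []")
      case True
      then have "x = enc_graph [v] es" using g(1) vs by simp
      then show ?thesis
        using machine_single_vertex single_vertex_no_solution unfolding poly by auto
    next
      case False
      interpret cut_instance v ws es
        by unfold_locales (use False g mg vs in auto)
      obtain us bs where sol:
        "outputs_within reduction.machine MaxAvgCut x (500 * (length x + 1) ^ 4)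
          (enc_vertices us @ enc_vertices bs)"
        "distinct us" "distinct bs" "max_average_partition (graph_of vs es) (set us) (set bs)"
        using machine_solves g(1) vs by (auto simp: n_def x_def)
      then have "enc_vertices us @ enc_vertices bs \<in> solutions MaxAvgCutOpt x"
        using g by (auto simp: MaxAvgCutOpt_def)
      then show ?thesis using sol(1) unfolding poly by auto
    qed
  qed
  then show ?thesis
    unfolding poly_time_turing_reducible_def using reduction.wf_machine by blast
qed

end
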